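(* Let $G$ be a graph. The graph $G \oplus K_2$ is the contact graph of a sphere packing with generic radii if and only if $G$ is both a forest and a penny graph. Furthermore, any sphere packing with generic radii and contact graph $G \oplus K_2$ is stress-free.
   Context: All graphs are finite and simple. $K_2$ is the complete graph on two vertices. The join $G_1 \oplus G_2$ of graphs $G_1, G_2$ (with disjoint vertex sets) is the graph formed from their disjoint union by connecting every vertex of $G_1$ to every vertex of $G_2$. A sphere packing is a triple $P=(H,p,r)$ where $H=(W,F)$ is a graph, and $p:W\to\mathbb{R}^3$ and $r:W\to\mathbb{R}_{>0}$ are maps such that $\|p_v-p_w\|\ge r_v+r_w$ for every distinct $v,w\in W$, with equality if and only if $vw\in F$. The graph $H$ is called the contact graph of $P$. The packing has generic radii if the indexed family $(r_v)_{v\in W}$ is algebraically independent over $\mathbb{Q}$ (in particular its elements are pairwise distinct). A graph $G=(V,E)$ is a penny graph if it is the contact graph of a packing of unit radius circles in the plane, i.e. there is $q:V\to\mathbb{R}^2$ with $\|q_v-q_w\|\ge 2$ for all distinct $v,w\in V$, with equality if and only if $vw\in E$. An equilibrium stress of $(H,p)$, with $H=(W,F)$ and $p:W\to\mathbb{R}^3$, is a map $\sigma:F\to\mathbb{R}$ such that $\sum_{w\in N_H(v)}\sigma_{vw}(p_v-p_w)=0$ for every $v\in W$, where $N_H(v)$ is the set of neighbours of $v$ in $H$. The sphere packing $(H,p,r)$ is stress-free if the only equilibrium stress of $(H,p)$ is the zero map. *)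

theory Defs
  imports
    "HOL-Analysis.Analysis"
    "HOL-Library.Poly_Mapping"
    "Graph_Theory.Kuratowski"
begin

text \<open>
  A finite simple graph is a \<^locale>\<open>pair_graph\<close>: a finite, loop-free, symmetric set of ordered
  pairs, so that an undirected edge is represented by its two opposite arcs.
\<close>

text \<open>
  The constant \<^const>\<open>forest\<close> of the graph library also counts the closed walk u, v, u as a cycle,
  so it excludes every symmetric digraph with an arc.  The cycles of an undirected graph are
  those of length at least 3.
\<close>

definition forest_graph :: "'a pair_pre_digraph \<Rightarrow> bool" where
  "forest_graph G \<longleftrightarrow> \<not> (\<exists>c. pre_digraph.cycle (with_proj G) c \<and> 3 \<le> length c)"

definition graph_join :: "'a pair_pre_digraph \<Rightarrow> 'b pair_pre_digraph \<Rightarrow> ('a + 'b) pair_pre_digraph" where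
  "graph_join G1 G2 =
     \<lparr> pverts = pverts G1 <+> pverts G2,
       parcs = {(Inl u, Inl v) | u v. (u, v) \<in> parcs G1}
             \<union> {(Inr u, Inr v) | u v. (u, v) \<in> parcs G2}
             \<union> {(Inl u, Inr v) | u v. u \<in> pverts G1 \<and> v \<in> pverts G2}
             \<union> {(Inr v, Inl u) | u v. u \<in> pverts G1 \<and> v \<in> pverts G2} \<rparr>"

definition K2 :: "bool pair_pre_digraph" where
  "K2 = \<lparr> pverts = UNIV, parcs = {(u, v). u \<noteq> v} \<rparr>"

lemma pair_graph_K2: "pair_graph K2"
  by unfold_locales (auto simp: K2_def symmetric_def intro: symI)

lemma complete_digraph_K2: "complete_digraph 2 (with_proj K2)"
proof -
  interpret pair_graph K2 by (rule pair_graph_K2)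
  have "graph (with_proj K2)" by unfold_locales
  then show ?thesis by (auto simp: complete_digraph_def K2_def)
qed

lemma pair_graph_graph_join:
  assumes "pair_graph G1" "pair_graph G2"
  shows "pair_graph (graph_join G1 G2)"
proof -
  interpret G1: pair_graph G1 by fact
  interpret G2: pair_graph G2 by fact
  have verts: "finite (pverts (graph_join G1 G2))"
    by (simp add: graph_join_def)
  have sub: "parcs (graph_join G1 G2) \<subseteq> pverts (graph_join G1 G2) \<times> pverts (graph_join G1 G2)"
    by (auto simp: graph_join_def G1.in_arcsD1 G1.in_arcsD2 G2.in_arcsD1 G2.in_arcsD2)
  have "sym (parcs G1)" "sym (parcs G2)"
    using G1.pair_sym_arcs G2.pair_sym_arcs by (auto simp: symmetric_def)
  then have sym: "sym (parcs (graph_join G1 G2))"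
    by (auto simp: graph_join_def sym_def)
  have loop: "fst e \<noteq> snd e" if "e \<in> parcs (graph_join G1 G2)" for e
    using that G1.pair_no_loops G2.pair_no_loops by (fastforce simp: graph_join_def)
  show ?thesis
    using verts sub sym loop finite_subset[OF sub]
    by unfold_locales (auto simp: symmetric_def)
qed

definition sphere_packing ::
  "'a pair_pre_digraph \<Rightarrow> ('a \<Rightarrow> real ^ 3) \<Rightarrow> ('a \<Rightarrow> real) \<Rightarrow> bool" where
  "sphere_packing H p r \<longleftrightarrow>
     pair_graph H \<and>
     (\<forall>v \<in> pverts H. 0 < r v) \<and>
     (\<forall>v \<in> pverts H. \<forall>w \<in> pverts H. v \<noteq> w \<longrightarrow>
        r v + r w \<le> norm (p v - p w) \<and>
        (norm (p v - p w) = r v + r w \<longleftrightarrow> (v, w) \<in> parcs H))"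

definition penny_graph :: "'a pair_pre_digraph \<Rightarrow> bool" where
  "penny_graph G \<longleftrightarrow>
     pair_graph G \<and>
     (\<exists>q :: 'a \<Rightarrow> real ^ 2. \<forall>v \<in> pverts G. \<forall>w \<in> pverts G. v \<noteq> w \<longrightarrow>
        2 \<le> norm (q v - q w) \<and>
        (norm (q v - q w) = 2 \<longleftrightarrow> (v, w) \<in> parcs G))"

text \<open>
  A polynomial over the rationals with variables of type 'v is a finitely supported map from
  monomials to coefficients, a monomial being a finitely supported map from variables to exponents.
\<close>

definition rat_mpoly_eval :: "('v \<Rightarrow> real) \<Rightarrow> (('v \<Rightarrow>\<^sub>0 nat) \<Rightarrow>\<^sub>0 rat) \<Rightarrow> real" where
  "rat_mpoly_eval x f =
     (\<Sum>m \<in> Poly_Mapping.keys f. of_rat (Poly_Mapping.lookup f m) *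
        (\<Prod>i \<in> Poly_Mapping.keys m. x i ^ Poly_Mapping.lookup m i))"

definition algebraically_independent_over_rat :: "'v set \<Rightarrow> ('v \<Rightarrow> real) \<Rightarrow> bool" where
  "algebraically_independent_over_rat I x \<longleftrightarrow>
     (\<forall>f :: ('v \<Rightarrow>\<^sub>0 nat) \<Rightarrow>\<^sub>0 rat.
        (\<forall>m \<in> Poly_Mapping.keys f. Poly_Mapping.keys m \<subseteq> I) \<and> rat_mpoly_eval x f = 0 \<longrightarrow> f = 0)"

definition generic_radii :: "'a pair_pre_digraph \<Rightarrow> ('a \<Rightarrow> real) \<Rightarrow> bool" where
  "generic_radii H r \<longleftrightarrow> algebraically_independent_over_rat (pverts H) r"

text \<open>
  A stress assigns one coefficient to each undirected edge; only its values on the two-element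
  sets {v, w} with vw an edge matter.
\<close>

definition equilibrium_stress ::
  "'a pair_pre_digraph \<Rightarrow> ('a \<Rightarrow> real ^ 3) \<Rightarrow> ('a set \<Rightarrow> real) \<Rightarrow> bool" where
  "equilibrium_stress H p \<sigma> \<longleftrightarrow>
     (\<forall>v \<in> pverts H. (\<Sum>w \<in> {w. (v, w) \<in> parcs H}. \<sigma> {v, w} *\<^sub>R (p v - p w)) = 0)"

definition stress_free :: "'a pair_pre_digraph \<Rightarrow> ('a \<Rightarrow> real ^ 3) \<Rightarrow> bool" where
  "stress_free H p \<longleftrightarrow>
     (\<forall>\<sigma>. equilibrium_stress H p \<sigma> \<longrightarrow> (\<forall>(v, w) \<in> parcs H. \<sigma> {v, w} = 0))"

end

theory Submission
  imports Defs
begin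

text \<open>
  Two apex spheres of radii a and b touch each other and every other sphere. An inversion at their
  point of contact turns them into two parallel planes and the other spheres into equal balls
  between the planes, whose centres form a penny packing of G. In coordinates this is an
  equivalence: sphere packings with contact graph G joined with K2 correspond to penny packings q
  of G in the plane in which |q v|^2 = s / r v + k, where s = 4ab / (a + b) and
  k = 4ab / (a + b)^2 (penny_position_of_sphere_packing and sphere_packing_of_penny_position). In
  particular G is a penny graph, and choosing radii means choosing distances of the pennies from
  the origin.

  Genericity is exploited through derivations of the field of real numbers. If the radii are
  algebraically independent, there is a derivation with arbitrary prescribed values on them
  (derivation_with_prescribed_values), and applying it to the coordinates of a packing yields an
  infinitesimal motion of the packing that changes the radii at the prescribed rates. Two
  consequences follow.

  A cycle is too rigid for this: changing the distance to the origin at just one vertex of the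
  cycle forces that vertex to be the midpoint of its two neighbours on the cycle, which fails for
  a vertex at maximal distance (forest_of_generic_sphere_packing).

  A stress annihilates all these motions, so it balances not only the vectors p v - p w but also
  the lengths r v + r w (stress_radius_equation). The vectors (p v - p w, r v + r w) in Lorentz
  space that belong to three spheres tangent to v are linearly independent. In a forest, some
  vertex among those with a stressed edge has at most three such edges, two of them to the apexes,
  so no edge at a vertex of G carries stress, and neither does the edge between the apexes
  (stress_free_of_generic_sphere_packing).

  Conversely, a forest of pennies is flexible enough to follow any small change of the distances
  to the origin (forest_flexible), and algebraically independent radii are dense
  (algebraically_independent_dense), so a penny packing of a forest yields a generic sphere
  packing (generic_sphere_packing_exists).
\<close>

section \<open>Evaluation of rational polynomials\<close>

definition monom_value :: "('v \<Rightarrow> real) \<Rightarrow> ('v \<Rightarrow>\<^sub>0 nat) \<Rightarrow> real" where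
  "monom_value x m = (\<Prod>i \<in> Poly_Mapping.keys m. x i ^ Poly_Mapping.lookup m i)"

lemma monom_value_superset:
  assumes "finite S" "Poly_Mapping.keys m \<subseteq> S"
  shows "monom_value x m = (\<Prod>i \<in> S. x i ^ Poly_Mapping.lookup m i)"
  unfolding monom_value_def
  by (rule prod.mono_neutral_left) (use assms in \<open>auto simp: in_keys_iff\<close>)

lemma monom_value_add: "monom_value x (m + n) = monom_value x m * monom_value x n"
proof -
  let ?S = "Poly_Mapping.keys m \<union> Poly_Mapping.keys n"
  have "Poly_Mapping.keys (m + n) \<subseteq> ?S"
    by (rule Poly_Mapping.keys_add)
  then have "monom_value x (m + n) = (\<Prod>i \<in> ?S. x i ^ Poly_Mapping.lookup (m + n) i)"
    by (intro monom_value_superset) auto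
  also have "\<dots> = (\<Prod>i \<in> ?S. x i ^ Poly_Mapping.lookup m i) * (\<Prod>i \<in> ?S. x i ^ Poly_Mapping.lookup n i)"
    by (simp add: lookup_add power_add prod.distrib)
  also have "\<dots> = monom_value x m * monom_value x n"
    by (simp add: monom_value_superset[of ?S m] monom_value_superset[of ?S n])
  finally show ?thesis .
qed

lemma rat_mpoly_eval_altdef:
  "rat_mpoly_eval x f = (\<Sum>m \<in> Poly_Mapping.keys f. of_rat (Poly_Mapping.lookup f m) * monom_value x m)"
  by (simp add: rat_mpoly_eval_def monom_value_def)

lemma rat_mpoly_eval_0 [simp]: "rat_mpoly_eval x 0 = 0"
  by (simp add: rat_mpoly_eval_altdef)

lemma rat_mpoly_eval_add: "rat_mpoly_eval x (f + g) = rat_mpoly_eval x f + rat_mpoly_eval x g"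
  unfolding rat_mpoly_eval_altdef
  by (rule setsum_keys_plus_distrib) (auto simp: of_rat_add algebra_simps)

lemma rat_mpoly_eval_sum: "rat_mpoly_eval x (sum h A) = (\<Sum>a\<in>A. rat_mpoly_eval x (h a))"
  by (induction A rule: infinite_finite_induct) (auto simp: rat_mpoly_eval_add)

lemma rat_mpoly_eval_uminus: "rat_mpoly_eval x (- f) = - rat_mpoly_eval x f"
  using rat_mpoly_eval_add[of x f "- f"] by simp

lemma rat_mpoly_eval_single:
  "rat_mpoly_eval x (Poly_Mapping.single m c) = of_rat c * monom_value x m"
  by (cases "c = 0") (auto simp: rat_mpoly_eval_altdef)

text \<open>
  Writing a polynomial as the sum of its terms reduces multiplicativity of evaluation to
  monomials.
\<close>

lemma poly_mapping_sum_singles: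
  fixes f :: "'k \<Rightarrow>\<^sub>0 'b::comm_monoid_add"
  shows "(\<Sum>m \<in> Poly_Mapping.keys f. Poly_Mapping.single m (Poly_Mapping.lookup f m)) = f"
  by (rule poly_mapping_eqI)
    (auto simp: lookup_sum lookup_single when_def in_keys_iff sum.delta)

lemma rat_mpoly_eval_mult: "rat_mpoly_eval x (f * g) = rat_mpoly_eval x f * rat_mpoly_eval x g"
proof -
  have "rat_mpoly_eval x (f * g) = rat_mpoly_eval x
      ((\<Sum>m \<in> Poly_Mapping.keys f. Poly_Mapping.single m (Poly_Mapping.lookup f m)) *
       (\<Sum>n \<in> Poly_Mapping.keys g. Poly_Mapping.single n (Poly_Mapping.lookup g n)))"
    by (simp add: poly_mapping_sum_singles)
  also have "\<dots> = (\<Sum>m \<in> Poly_Mapping.keys f. \<Sum>n \<in> Poly_Mapping.keys g.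
      (of_rat (Poly_Mapping.lookup f m) * monom_value x m) *
      (of_rat (Poly_Mapping.lookup g n) * monom_value x n))"
    by (simp add: sum_product mult_single rat_mpoly_eval_sum rat_mpoly_eval_single monom_value_add
        of_rat_mult mult_ac)
  also have "\<dots> = rat_mpoly_eval x f * rat_mpoly_eval x g"
    by (simp only: rat_mpoly_eval_altdef sum_product)
  finally show ?thesis .
qed

lemma rat_mpoly_eval_one [simp]: "rat_mpoly_eval x 1 = 1"
  using rat_mpoly_eval_single[of x 0 1] by (simp add: monom_value_def)

lemma rat_mpoly_eval_var: "rat_mpoly_eval x (Poly_Mapping.single (Poly_Mapping.single i 1) 1) = x i"
  by (simp add: rat_mpoly_eval_single monom_value_def)

definition mpoly_in :: "'v set \<Rightarrow> (('v \<Rightarrow>\<^sub>0 nat) \<Rightarrow>\<^sub>0 rat) \<Rightarrow> bool" where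
  "mpoly_in I f \<longleftrightarrow> (\<forall>m \<in> Poly_Mapping.keys f. Poly_Mapping.keys m \<subseteq> I)"

lemma mpoly_in_add: "mpoly_in I f \<Longrightarrow> mpoly_in I g \<Longrightarrow> mpoly_in I (f + g)"
  using Poly_Mapping.keys_add[of f g] by (auto simp: mpoly_in_def)

lemma mpoly_in_uminus: "mpoly_in I f \<Longrightarrow> mpoly_in I (- f)"
  by (auto simp: mpoly_in_def in_keys_iff)

lemma mpoly_in_mult:
  assumes "mpoly_in I f" "mpoly_in I g"
  shows "mpoly_in I (f * g)"
  unfolding mpoly_in_def
proof
  fix m assume "m \<in> Poly_Mapping.keys (f * g)"
  then obtain a b where ab: "a \<in> Poly_Mapping.keys f" "b \<in> Poly_Mapping.keys g" "m = a + b"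
    using keys_mult[of f g] by auto
  have "Poly_Mapping.keys m \<subseteq> Poly_Mapping.keys a \<union> Poly_Mapping.keys b"
    unfolding ab(3) by (rule Poly_Mapping.keys_add)
  with ab assms show "Poly_Mapping.keys m \<subseteq> I"
    by (force simp: mpoly_in_def)
qed

lemma mpoly_in_sum: "(\<And>a. a \<in> A \<Longrightarrow> mpoly_in I (h a)) \<Longrightarrow> mpoly_in I (sum h A)"
  by (induction A rule: infinite_finite_induct) (auto simp: mpoly_in_add, auto simp: mpoly_in_def)

lemma algebraically_independent_altdef:
  "algebraically_independent_over_rat I x \<longleftrightarrow> (\<forall>f. mpoly_in I f \<and> rat_mpoly_eval x f = 0 \<longrightarrow> f = 0)"
  by (simp add: algebraically_independent_over_rat_def mpoly_in_def)

text \<open>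
  Directional derivatives of a polynomial are taken as derivatives along a line, so that the sum
  and product rules come from calculus and no formal partial derivatives are needed.
\<close>

lemma rat_mpoly_eval_line_differentiable:
  "(\<lambda>t. rat_mpoly_eval (\<lambda>i. x i + t * d i) f) differentiable at (t0::real)"
proof -
  have "(\<lambda>t. monom_value (\<lambda>i. x i + t * d i) m) differentiable at t0" for m
  proof -
    have "\<exists>D. ((\<lambda>t. \<Prod>i \<in> K. (x i + t * d i) ^ e i) has_real_derivative D) (at t0)"
      if "finite K" for K e
      using that
    proof (induction K rule: finite_induct)
      case empty
      then show ?case by (auto intro!: exI[of _ 0])
    next
      case (insert k K)
      then obtain D where D: "((\<lambda>t. \<Prod>i \<in> K. (x i + t * d i) ^ e i) has_real_derivative D) (at t0)"
        by blast
      have "\<exists>E. ((\<lambda>t. (x k + t * d k) ^ e k) has_real_derivative E) (at t0)"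
        by (rule exI, (rule derivative_eq_intros refl)+)
      then obtain E where "((\<lambda>t. (x k + t * d k) ^ e k) has_real_derivative E) (at t0)" ..
      from DERIV_mult[OF this D] insert.hyps show ?case
        by auto
    qed
    from this[OF finite_keys] show ?thesis
      unfolding monom_value_def real_differentiable_def .
  qed
  then show ?thesis
    unfolding rat_mpoly_eval_altdef by (intro differentiable_sum differentiable_mult) auto
qed

section \<open>Derivations of the real numbers\<close>

text \<open>
  A derivation on a subring of the reals, given by its graph. Reading (a, a') as a + a' * eps with
  eps^2 = 0, the graph is a subring of the dual numbers, and the last clause, which says that this
  subring contains no nonzero multiple of eps, makes it the graph of a function.
\<close>

definition partial_derivation :: "(real \<times> real) set \<Rightarrow> bool" where
  "partial_derivation S \<longleftrightarrow>
     (1, 0) \<in> S \<and>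
     (\<forall>a a' b b'. (a, a') \<in> S \<longrightarrow> (b, b') \<in> S \<longrightarrow>
        (a + b, a' + b') \<in> S \<and> (a * b, a * b' + a' * b) \<in> S \<and> (- a, - a') \<in> S) \<and>
     (\<forall>e. (0, e) \<in> S \<longrightarrow> e = 0)"

text \<open>
  On the ring generated by an algebraically independent family x, the map f(x) to
  (d/dt) f(x + t d) at t = 0 is well defined, because f(x) determines the polynomial f.
\<close>

lemma partial_derivation_rational_functions:
  assumes "algebraically_independent_over_rat I x"
  shows "\<exists>S. partial_derivation S \<and> (\<forall>i\<in>I. (x i, d i) \<in> S)"
proof -
  define \<delta> where "\<delta> f = deriv (\<lambda>t. rat_mpoly_eval (\<lambda>i. x i + t * d i) f) (0::real)" for f
  define S where "S = {(rat_mpoly_eval x f, \<delta> f) | f. mpoly_in I f}"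
  have D: "((\<lambda>t. rat_mpoly_eval (\<lambda>i. x i + t * d i) f) has_real_derivative \<delta> f) (at 0)" for f
    unfolding \<delta>_def using rat_mpoly_eval_line_differentiable[of x d f 0]
    by (simp add: DERIV_deriv_iff_real_differentiable)
  have \<delta>_eqI: "((\<lambda>t. rat_mpoly_eval (\<lambda>i. x i + t * d i) f) has_real_derivative y) (at 0) \<Longrightarrow> \<delta> f = y" for f y
    using D DERIV_unique by blast
  have \<delta>_add: "\<delta> (f + g) = \<delta> f + \<delta> g" for f g
    by (rule \<delta>_eqI) (simp only: rat_mpoly_eval_add, rule DERIV_add[OF D D])
  have \<delta>_uminus: "\<delta> (- f) = - \<delta> f" for f
    by (rule \<delta>_eqI) (simp only: rat_mpoly_eval_uminus, rule DERIV_minus[OF D])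
  have \<delta>_mult: "\<delta> (f * g) = rat_mpoly_eval x f * \<delta> g + \<delta> f * rat_mpoly_eval x g" for f g
    by (rule \<delta>_eqI) (use DERIV_mult[OF D[of f] D[of g]] in \<open>simp add: rat_mpoly_eval_mult algebra_simps\<close>)
  have \<delta>_one: "\<delta> 1 = 0" and \<delta>_zero: "\<delta> 0 = 0"
    by (rule \<delta>_eqI, simp)+
  have \<delta>_var: "\<delta> (Poly_Mapping.single (Poly_Mapping.single i 1) 1) = d i" for i
    by (rule \<delta>_eqI, simp only: rat_mpoly_eval_var, (rule derivative_eq_intros refl | simp)+)
  have "(x i, d i) \<in> S" if "i \<in> I" for i
  proof -
    have "mpoly_in I (Poly_Mapping.single (Poly_Mapping.single i 1) 1)"
      using that by (auto simp: mpoly_in_def)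
    then show ?thesis
      unfolding S_def using \<delta>_var[of i] rat_mpoly_eval_var[of x i]
      by (intro CollectI exI[of _ "Poly_Mapping.single (Poly_Mapping.single i 1) 1"]) simp
  qed
  moreover have "partial_derivation S"
    unfolding partial_derivation_def
  proof (intro conjI allI impI)
    show "(1, 0) \<in> S"
      unfolding S_def by (rule CollectI, rule exI[of _ 1]) (auto simp: \<delta>_one mpoly_in_def)
  next
    fix e assume "(0, e) \<in> S"
    then show "e = 0"
      using assms \<delta>_zero by (auto simp: S_def algebraically_independent_altdef)
  next
    fix a a' b b' assume "(a, a') \<in> S" "(b, b') \<in> S"
    then obtain f g where fg: "mpoly_in I f" "mpoly_in I g"
      "a = rat_mpoly_eval x f" "a' = \<delta> f" "b = rat_mpoly_eval x g" "b' = \<delta> g"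
      by (auto simp: S_def)
    show "(a + b, a' + b') \<in> S"
      unfolding S_def using fg mpoly_in_add[of I f g]
      by (intro CollectI exI[of _ "f + g"]) (simp add: rat_mpoly_eval_add \<delta>_add)
    show "(a * b, a * b' + a' * b) \<in> S"
      unfolding S_def using fg mpoly_in_mult[of I f g]
      by (intro CollectI exI[of _ "f * g"]) (simp add: rat_mpoly_eval_mult \<delta>_mult)
    show "(- a, - a') \<in> S"
      unfolding S_def using fg mpoly_in_uminus[of I f]
      by (intro CollectI exI[of _ "- f"]) (simp add: rat_mpoly_eval_uminus \<delta>_uminus)
  qed
  ultimately show ?thesis by blast
qed

text \<open>
  The elements g(t) of the ring R[t] receive the derivative g^D(t) + g'(t) s, where g^D arises
  from g by deriving its coefficients. This is well defined if it vanishes for every relation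
  g(t) = 0. If t satisfies a relation g0 of least degree, then g0'(t) is not zero by minimality,
  so s can be chosen to make g0 harmless, and every other relation becomes a multiple of g0 after
  multiplication by a power of the leading coefficient of g0.
\<close>

lemma partial_derivation_extend:
  assumes M: "partial_derivation M"
  shows "\<exists>S s. partial_derivation S \<and> M \<subseteq> S \<and> (t, s) \<in> S"
proof -
  define R where "R = fst ` M"
  define D where "D a = (SOME e. (a, e) \<in> M)" for a
  have M_one: "(1, 0) \<in> M"
    and M_add: "(a, a') \<in> M \<Longrightarrow> (b, b') \<in> M \<Longrightarrow> (a + b, a' + b') \<in> M"
    and M_mult: "(a, a') \<in> M \<Longrightarrow> (b, b') \<in> M \<Longrightarrow> (a * b, a * b' + a' * b) \<in> M"
    and M_uminus: "(a, a') \<in> M \<Longrightarrow> (- a, - a') \<in> M"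
    and M_zero: "(0, e) \<in> M \<Longrightarrow> e = 0" for a a' b b' e
    using M unfolding partial_derivation_def by blast+
  have DI: "(a, D a) \<in> M" if "a \<in> R" for a
    using that unfolding R_def D_def by (auto intro: someI)
  have unique: "e = e'" if "(a, e) \<in> M" "(a, e') \<in> M" for a e e'
    using M_zero[of "e - e'"] M_add[OF that(1) M_uminus[OF that(2)]] by simp
  have R_I: "a \<in> R" and D_eqI: "D a = e" if "(a, e) \<in> M" for a e
    using that DI[of a] unique[of a e "D a"] unfolding R_def by force+
  have R_add: "a + b \<in> R" and D_add: "D (a + b) = D a + D b" if "a \<in> R" "b \<in> R" for a b
    using M_add[OF DI DI, of a b] that R_I D_eqI by blast+
  have R_mult: "a * b \<in> R" and D_mult: "D (a * b) = a * D b + D a * b" if "a \<in> R" "b \<in> R" for a b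
    using M_mult[OF DI DI, of a b] that R_I D_eqI by blast+
  have R_uminus: "- a \<in> R" and D_uminus: "D (- a) = - D a" if "a \<in> R" for a
    using M_uminus[OF DI, of a] that R_I D_eqI by blast+
  have R_1: "1 \<in> R" and D_1: "D 1 = 0"
    using M_one R_I D_eqI by blast+
  have R_0: "0 \<in> R" and D_0 [simp]: "D 0 = 0"
    using R_add[OF R_1 R_uminus[OF R_1]] D_add[OF R_1 R_uminus[OF R_1]] D_uminus[OF R_1] by simp_all
  have R_of_nat: "of_nat n \<in> R" for n
    by (induction n) (auto simp: R_0 R_1 R_add)
  have R_sum: "(\<Sum>i\<in>A. f i) \<in> R" and D_sum: "D (\<Sum>i\<in>A. f i) = (\<Sum>i\<in>A. D (f i))"
    if "\<And>i. i \<in> A \<Longrightarrow> f i \<in> R" for A :: "nat set" and f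
  proof -
    have "(\<Sum>i\<in>A. f i) \<in> R \<and> D (\<Sum>i\<in>A. f i) = (\<Sum>i\<in>A. D (f i))"
      using that by (induction A rule: infinite_finite_induct) (auto simp: R_0 R_add D_add)
    then show "(\<Sum>i\<in>A. f i) \<in> R" "D (\<Sum>i\<in>A. f i) = (\<Sum>i\<in>A. D (f i))" by auto
  qed

  define RX where "RX = {g :: real poly. \<forall>i. coeff g i \<in> R}"
  have RX_coeff: "coeff g i \<in> R" if "g \<in> RX" for g i
    using that by (simp add: RX_def)
  have RX_add: "g + h \<in> RX" if "g \<in> RX" "h \<in> RX" for g h
    using that by (simp add: RX_def R_add)
  have RX_uminus: "- g \<in> RX" if "g \<in> RX" for g
    using that by (simp add: RX_def R_uminus)
  have RX_mult: "g * h \<in> RX" if "g \<in> RX" "h \<in> RX" for g h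
  proof -
    have "(\<Sum>i\<le>n. coeff g i * coeff h (n - i)) \<in> R" for n
      using that by (intro R_sum R_mult RX_coeff)
    then show ?thesis by (simp add: RX_def coeff_mult)
  qed
  have RX_monom: "monom a n \<in> RX" if "a \<in> R" for a n
    using that by (simp add: RX_def R_0)
  have RX_const: "[:a:] \<in> RX" if "a \<in> R" for a
    using RX_monom[OF that, of 0] by (simp add: monom_0)
  have RX_pderiv: "pderiv g \<in> RX" if "g \<in> RX" for g
  proof -
    have "coeff (pderiv g) i \<in> R" for i
      unfolding coeff_pderiv using that by (intro R_mult R_of_nat RX_coeff)
    then show ?thesis by (simp add: RX_def)
  qed

  define \<delta> where "\<delta> s g = poly (map_poly D g) t + poly (pderiv g) t * s" for s g
  have \<delta>_add: "\<delta> s (g + h) = \<delta> s g + \<delta> s h" if "g \<in> RX" "h \<in> RX" for s g h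
  proof -
    have "map_poly D (g + h) = map_poly D g + map_poly D h"
      by (rule poly_eqI) (simp add: coeff_map_poly D_add RX_coeff that)
    then show ?thesis by (simp add: \<delta>_def pderiv_add algebra_simps)
  qed
  have \<delta>_uminus: "\<delta> s (- g) = - \<delta> s g" if "g \<in> RX" for s g
  proof -
    have "map_poly D (- g) = - map_poly D g"
      by (rule poly_eqI) (simp add: coeff_map_poly D_uminus RX_coeff that)
    then show ?thesis by (simp add: \<delta>_def pderiv_minus algebra_simps)
  qed
  have \<delta>_mult: "\<delta> s (g * h) = poly g t * \<delta> s h + \<delta> s g * poly h t" if "g \<in> RX" "h \<in> RX" for s g h
  proof -
    have "map_poly D (g * h) = g * map_poly D h + map_poly D g * h"
    proof (rule poly_eqI)
      fix n
      have "D (coeff (g * h) n) = (\<Sum>i\<le>n. D (coeff g i * coeff h (n - i)))"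
        unfolding coeff_mult using that by (intro D_sum R_mult RX_coeff)
      also have "\<dots> = (\<Sum>i\<le>n. coeff g i * D (coeff h (n - i)) + D (coeff g i) * coeff h (n - i))"
        by (intro sum.cong refl D_mult RX_coeff that)
      also have "\<dots> = coeff (g * map_poly D h + map_poly D g * h) n"
        by (simp add: coeff_mult coeff_map_poly sum.distrib)
      finally show "coeff (map_poly D (g * h)) n = coeff (g * map_poly D h + map_poly D g * h) n"
        by (simp add: coeff_map_poly)
    qed
    then show ?thesis by (simp add: \<delta>_def pderiv_mult algebra_simps)
  qed
  have \<delta>_const: "\<delta> s [:a:] = D a" for s a
    by (simp add: \<delta>_def map_poly_pCons pderiv_pCons)

  \<comment> \<open>If t is algebraic, the derivative of t is forced by a relation g0 of least degree; otherwise any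
    value would do.\<close>
  have "\<exists>s. \<forall>g\<in>RX. poly g t = 0 \<longrightarrow> \<delta> s g = 0"
  proof (cases "\<exists>g\<in>RX. poly g t = 0 \<and> g \<noteq> 0")
    case False
    have "\<delta> 0 0 = 0" by (simp add: \<delta>_def)
    with False show ?thesis by metis
  next
    case True
    define P where "P g \<longleftrightarrow> g \<in> RX \<and> poly g t = 0 \<and> g \<noteq> 0" for g
    define g0 where "g0 = arg_min degree P"
    have "P g0" and least: "\<And>g. P g \<Longrightarrow> degree g0 \<le> degree g"
      unfolding g0_def using True arg_min_natI[of P _ degree] arg_min_nat_le[of P _ degree]
      by (auto simp: P_def)
    then have g0: "g0 \<in> RX" "poly g0 t = 0" "g0 \<noteq> 0"
      by (auto simp: P_def)
    have "degree g0 \<noteq> 0"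
    proof
      assume "degree g0 = 0"
      then obtain c where "g0 = [:c:]"
        by (rule degree_eq_zeroE)
      with g0 show False by simp
    qed
    then have "pderiv g0 \<noteq> 0" "degree (pderiv g0) < degree g0"
      by (auto simp: pderiv_eq_0_iff degree_pderiv)
    then have nz: "poly (pderiv g0) t \<noteq> 0"
      using least[of "pderiv g0"] RX_pderiv[OF g0(1)] by (auto simp: P_def)
    define s where "s = - poly (map_poly D g0) t / poly (pderiv g0) t"
    have \<delta>_g0: "\<delta> s g0 = 0"
      using nz by (simp add: \<delta>_def s_def)
    have "\<delta> s g = 0" if "g \<in> RX" "poly g t = 0" for g
      using that
    proof (induction "degree g" arbitrary: g rule: less_induct)
      case less
      show ?case
      proof (cases "g = 0")
        case True
        then show ?thesis by (simp add: \<delta>_def)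
      next
        case False
        then have deg: "degree g0 \<le> degree g"
          using least[of g] less.prems by (simp add: P_def)
        let ?c = "lead_coeff g0" and ?m = "monom (lead_coeff g) (degree g - degree g0)"
        have cR: "?c \<in> R" and mR: "?m \<in> RX"
          using g0 less.prems by (auto intro!: RX_monom RX_coeff)
        define h where "h = [:?c:] * g + - (?m * g0)"
        have h: "h \<in> RX"
          unfolding h_def using g0 less.prems cR mR by (intro RX_add RX_mult RX_uminus RX_const)
        have "poly h t = 0"
          unfolding h_def using g0 less.prems by simp
        \<comment> \<open>h is the first step of the division of g by g0, so its degree is smaller.\<close>
        have "\<delta> s h = 0"
        proof (cases "h = 0")
          case True
          then show ?thesis by (simp add: \<delta>_def)
        next
          case False
          have "degree h \<le> degree g"
            unfolding h_def
            by (rule degree_add_le) (use deg degree_mult_le[of ?m g0] in \<open>auto simp: degree_monom_eq \<open>g \<noteq> 0\<close>\<close>)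
          moreover have "coeff h (degree g) = 0"
            using coeff_mult_degree_sum[of ?m g0] deg
            by (simp add: h_def degree_monom_eq \<open>g \<noteq> 0\<close>)
          ultimately have "degree h < degree g"
            using False by (metis leading_coeff_0_iff le_neq_implies_less)
          with less.hyps h \<open>poly h t = 0\<close> show ?thesis by blast
        qed
        moreover have "\<delta> s h = ?c * \<delta> s g"
          unfolding h_def using g0 less.prems cR mR \<delta>_g0
          by (simp only: \<delta>_add \<delta>_mult \<delta>_uminus RX_const RX_mult RX_uminus) simp
        ultimately show ?thesis using g0 by simp
      qed
    qed
    then show ?thesis by blast
  qed
  then obtain s where s: "\<And>g. g \<in> RX \<Longrightarrow> poly g t = 0 \<Longrightarrow> \<delta> s g = 0" by blast

  define S where "S = {(poly g t, \<delta> s g) | g. g \<in> RX}"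
  have S_I: "g \<in> RX \<Longrightarrow> a = poly g t \<Longrightarrow> e = \<delta> s g \<Longrightarrow> (a, e) \<in> S" for g a e
    by (auto simp: S_def)
  have MS: "M \<subseteq> S"
  proof
    fix z assume "z \<in> M"
    then show "z \<in> S"
      using R_I D_eqI by (cases z, auto intro!: S_I[of "[:fst z:]"] RX_const simp: \<delta>_const)
  qed
  have "(t, s) \<in> S"
    by (rule S_I[of "[:0, 1:]"]) (auto simp: RX_def R_0 R_1 coeff_pCons \<delta>_def map_poly_pCons D_1 pderiv_pCons split: nat.split)
  moreover have "partial_derivation S"
    unfolding partial_derivation_def
  proof (intro conjI allI impI)
    show "(1, 0) \<in> S" using M_one MS by blast
  next
    fix a a' b b' assume "(a, a') \<in> S" "(b, b') \<in> S"
    then obtain g h where gh: "g \<in> RX" "h \<in> RX"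
      and [simp]: "a = poly g t" "a' = \<delta> s g" "b = poly h t" "b' = \<delta> s h"
      by (auto simp: S_def)
    show "(a + b, a' + b') \<in> S"
      using gh by (intro S_I[of "g + h"]) (simp_all add: RX_add \<delta>_add)
    show "(a * b, a * b' + a' * b) \<in> S"
      using gh by (intro S_I[of "g * h"]) (simp_all add: RX_mult \<delta>_mult)
    show "(- a, - a') \<in> S"
      using gh by (intro S_I[of "- g"]) (simp_all add: RX_uminus \<delta>_uminus)
  next
    fix e assume "(0, e) \<in> S"
    then show "e = 0" using s by (auto simp: S_def)
  qed
  ultimately show ?thesis using MS by blast
qed

definition derivation :: "(real \<Rightarrow> real) \<Rightarrow> bool" where
  "derivation D \<longleftrightarrow> (\<forall>a b. D (a + b) = D a + D b \<and> D (a * b) = a * D b + D a * b)"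

text \<open>
  Zorn: a maximal partial derivation is defined everywhere, since it could be extended to a
  missing point.
\<close>

lemma partial_derivation_total:
  assumes "partial_derivation S0"
  shows "\<exists>D. derivation D \<and> (\<forall>(a, e)\<in>S0. D a = e)"
proof -
  let ?A = "{S. partial_derivation S \<and> S0 \<subseteq> S}"
  have "\<exists>M\<in>?A. \<forall>S\<in>?A. M \<subseteq> S \<longrightarrow> S = M"
  proof (rule subset_Zorn_nonempty)
    show "?A \<noteq> {}" using assms by auto
  next
    fix C assume C: "C \<noteq> {}" "subset.chain ?A C"
    have sub: "partial_derivation S \<and> S0 \<subseteq> S" if "S \<in> C" for S
      using C(2) that unfolding subset_chain_def by blast
    have total: "S \<subseteq> T \<or> T \<subseteq> S" if "S \<in> C" "T \<in> C" for S T
      using C(2) that unfolding subset_chain_def by blast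
    have "partial_derivation (\<Union>C)"
      unfolding partial_derivation_def
    proof (intro conjI allI impI)
      show "(1, 0) \<in> \<Union>C"
        using C(1) sub by (auto simp: partial_derivation_def)
    next
      fix a a' b b' assume "(a, a') \<in> \<Union>C" "(b, b') \<in> \<Union>C"
      then obtain S T where "S \<in> C" "(a, a') \<in> S" "T \<in> C" "(b, b') \<in> T"
        by blast
      with total[of S T] have "\<exists>S\<in>C. (a, a') \<in> S \<and> (b, b') \<in> S"
        by blast
      then obtain S where S: "S \<in> C" "(a, a') \<in> S" "(b, b') \<in> S"
        by blast
      then show "(a + b, a' + b') \<in> \<Union>C" "(a * b, a * b' + a' * b) \<in> \<Union>C" "(- a, - a') \<in> \<Union>C"
        using sub[OF S(1)] unfolding partial_derivation_def by blast+
    next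
      fix e assume "(0, e) \<in> \<Union>C"
      then show "e = 0" using sub unfolding partial_derivation_def by blast
    qed
    then show "\<Union>C \<in> ?A" using C(1) sub by blast
  qed
  then obtain M where "M \<in> ?A" and max: "\<forall>S\<in>?A. M \<subseteq> S \<longrightarrow> S = M" ..
  then have M: "partial_derivation M" "S0 \<subseteq> M"
    by simp_all
  have maximal: "S = M" if "partial_derivation S" "S0 \<subseteq> S" "M \<subseteq> S" for S
    using max that by simp
  have "\<exists>e. (a, e) \<in> M" for a
  proof -
    obtain S e where S: "partial_derivation S" "M \<subseteq> S" "(a, e) \<in> S"
      using partial_derivation_extend[OF M(1), of a] by blast
    have "S = M"
      by (rule maximal[OF S(1) order_trans[OF M(2) S(2)] S(2)])
    with S(3) show ?thesis by blast
  qed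
  then have "\<exists>D. \<forall>a. (a, D a) \<in> M"
    by (intro choice allI)
  then obtain D where D: "\<And>a. (a, D a) \<in> M"
    by blast
  have unique: "D a = e" if "(a, e) \<in> M" for a e
  proof -
    have "(- a, - e) \<in> M"
      using that M(1) unfolding partial_derivation_def by blast
    then have "(a + - a, D a + - e) \<in> M"
      using D[of a] M(1) unfolding partial_derivation_def by blast
    then show ?thesis
      using M(1) unfolding partial_derivation_def by auto
  qed
  have "(a + b, D a + D b) \<in> M" "(a * b, a * D b + D a * b) \<in> M" for a b
    using D[of a] D[of b] M(1) unfolding partial_derivation_def by blast+
  then have "derivation D"
    unfolding derivation_def using unique by blast
  then show ?thesis using unique M(2) by blast
qed

text \<open>
  Algebraic independence is used through derivations: an algebraic relation between the x i
  differentiates to a linear one, which fails for a suitable choice of the values d i.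
\<close>

theorem derivation_with_prescribed_values:
  assumes "algebraically_independent_over_rat I x"
  obtains D where "derivation D" "\<And>i. i \<in> I \<Longrightarrow> D (x i) = d i"
proof -
  obtain S where "partial_derivation S" "\<forall>i\<in>I. (x i, d i) \<in> S"
    using partial_derivation_rational_functions[OF assms] by blast
  moreover obtain D where "derivation D" "\<forall>(a, e)\<in>S. D a = e"
    using partial_derivation_total[OF calculation(1)] by blast
  ultimately show ?thesis
    by (intro that[of D]) auto
qed

lemma derivation_add: "derivation D \<Longrightarrow> D (a + b) = D a + D b"
  and derivation_mult: "derivation D \<Longrightarrow> D (a * b) = a * D b + D a * b"
  by (simp_all add: derivation_def)

lemma derivation_0 [simp]: "derivation D \<Longrightarrow> D 0 = 0"
  using derivation_add[of D 0 0] by simp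

lemma derivation_uminus: "derivation D \<Longrightarrow> D (- a) = - D a"
  using derivation_add[of D a "- a"] by simp

lemma derivation_diff: "derivation D \<Longrightarrow> D (a - b) = D a - D b"
  using derivation_add[of D a "- b"] by (simp add: derivation_uminus)

lemma derivation_of_nat [simp]: "derivation D \<Longrightarrow> D (of_nat n) = 0"
proof (induction n)
  case (Suc n)
  then show ?case using derivation_mult[of D 1 1] by (simp add: derivation_add)
qed simp

lemma derivation_numeral [simp]: "derivation D \<Longrightarrow> D (numeral n) = 0"
  using derivation_of_nat[of D "numeral n"] by simp

lemma derivation_power2: "derivation D \<Longrightarrow> D (a\<^sup>2) = 2 * a * D a"
  by (simp add: power2_eq_square derivation_mult)

lemma derivation_divide:
  assumes "derivation D" "b \<noteq> 0"
  shows "D (a / b) = (D a * b - a * D b) / b\<^sup>2"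
proof -
  have "D a = D (a / b * b)" using assms by simp
  also have "\<dots> = a / b * D b + D (a / b) * b"
    using assms(1) by (rule derivation_mult)
  finally show ?thesis
    using assms(2) by (simp add: field_simps power2_eq_square)
qed

section \<open>Algebraically independent families are dense\<close>

lemma countable_poly_mapping:
  assumes "countable A" "countable B"
  shows "countable {f :: 'k \<Rightarrow>\<^sub>0 'b::zero. Poly_Mapping.keys f \<subseteq> A \<and> Poly_Mapping.range f \<subseteq> B}"
    (is "countable ?S")
proof -
  define graph where "graph f = (\<lambda>k. (k, Poly_Mapping.lookup f k)) ` Poly_Mapping.keys f" for f :: "'k \<Rightarrow>\<^sub>0 'b"
  have "inj graph"
  proof (rule injI, rule poly_mapping_eqI)
    fix f g k assume eq: "graph f = graph g"
    show "Poly_Mapping.lookup f k = Poly_Mapping.lookup g k"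
    proof (cases "k \<in> Poly_Mapping.keys f \<or> k \<in> Poly_Mapping.keys g")
      case True
      then have "(k, Poly_Mapping.lookup f k) \<in> graph f \<or> (k, Poly_Mapping.lookup g k) \<in> graph g"
        by (auto simp: graph_def)
      then have "(k, Poly_Mapping.lookup f k) \<in> graph g \<or> (k, Poly_Mapping.lookup g k) \<in> graph f"
        by (simp add: eq)
      then show ?thesis by (auto simp: graph_def)
    qed (simp add: in_keys_iff)
  qed
  moreover have "graph ` ?S \<subseteq> {X. finite X \<and> X \<subseteq> A \<times> B}"
    by (auto simp: graph_def)
  then have "countable (graph ` ?S)"
    by (rule countable_subset) (intro countable_Collect_finite_subset countable_SIGMA assms)
  ultimately show ?thesis
    by (meson countable_image_inj_on inj_on_subset subset_UNIV)
qed

lemma countable_mpoly_in: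
  fixes I :: "'v set"
  assumes "countable I"
  shows "countable {f. mpoly_in I f}"
proof -
  have "countable {m :: 'v \<Rightarrow>\<^sub>0 nat. Poly_Mapping.keys m \<subseteq> I \<and> Poly_Mapping.range m \<subseteq> UNIV}"
    using assms by (intro countable_poly_mapping) auto
  from countable_poly_mapping[OF this, of "UNIV :: rat set"] show ?thesis
    by (rule countable_subset[rotated]) (auto simp: mpoly_in_def)
qed

text \<open>
  A relation between x and a new element t is a polynomial in t whose coefficients are values of
  polynomials at x; if t is not a root, all these coefficients vanish, hence are zero by the
  independence of x.
\<close>

lemma algebraically_independent_extend:
  assumes indep: "algebraically_independent_over_rat I x" and "i \<notin> I"
    and t: "\<And>p. p \<noteq> 0 \<Longrightarrow> (\<And>k. \<exists>g. mpoly_in I g \<and> coeff p k = rat_mpoly_eval x g) \<Longrightarrow> poly p t \<noteq> 0"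
  shows "algebraically_independent_over_rat (insert i I) (x(i := t))"
  unfolding algebraically_independent_altdef
proof (intro allI impI, elim conjE)
  fix f assume f: "mpoly_in (insert i I) f" "rat_mpoly_eval (x(i := t)) f = 0"
  let ?lk = "Poly_Mapping.lookup" and ?keys = "Poly_Mapping.keys" and ?X = "Poly_Mapping.single i (1::nat)"
  \<comment> \<open>f is the sum of the c k * X^k, where X is the variable i and X does not occur in c k.\<close>
  define rest where "rest m = m - Poly_Mapping.single i (?lk m i)" for m :: "'a \<Rightarrow>\<^sub>0 nat"
  define c where "c k = (\<Sum>m \<in> {m \<in> ?keys f. ?lk m i = k}. Poly_Mapping.single (rest m) (?lk f m))" for k
  have lk_rest: "?lk (rest m) j = (if j = i then 0 else ?lk m j)" for m j
    by (simp add: rest_def lookup_minus lookup_single when_def)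
  have rest_inj: "m = m'" if "rest m = rest m'" "?lk m i = ?lk m' i" for m m'
  proof (rule poly_mapping_eqI)
    show "?lk m j = ?lk m' j" for j
      using lk_rest[of m j] lk_rest[of m' j] that by (cases "j = i") auto
  qed
  have c_in: "mpoly_in I (c k)" for k
    unfolding c_def
  proof (rule mpoly_in_sum)
    fix m assume "m \<in> {m \<in> ?keys f. ?lk m i = k}"
    with f(1) have "?keys m \<subseteq> insert i I" by (auto simp: mpoly_in_def)
    moreover have "?keys (rest m) = ?keys m - {i}"
      by (auto simp: in_keys_iff lk_rest split: if_splits)
    ultimately have "?keys (rest m) \<subseteq> I" by blast
    then show "mpoly_in I (Poly_Mapping.single (rest m) (?lk f m))"
      by (auto simp: mpoly_in_def)
  qed
  have c_lookup: "?lk (c (?lk m i)) (rest m) = ?lk f m" if "m \<in> ?keys f" for m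
  proof -
    have "?lk (c (?lk m i)) (rest m) =
        (\<Sum>m' \<in> {m' \<in> ?keys f. ?lk m' i = ?lk m i}. if m' = m then ?lk f m else 0)"
      unfolding c_def lookup_sum
      by (rule sum.cong) (auto simp: lookup_single when_def dest: rest_inj)
    then show ?thesis using that by simp
  qed
  have monom_at: "monom_value (x(i := t)) m = monom_value x (rest m) * t ^ ?lk m i" for m
  proof -
    have "monom_value (x(i := t)) m = (\<Prod>j \<in> insert i (?keys m). (x(i := t)) j ^ ?lk m j)"
      by (rule monom_value_superset) auto
    also have "\<dots> = t ^ ?lk m i * (\<Prod>j \<in> ?keys m - {i}. (x(i := t)) j ^ ?lk m j)"
      by (subst prod.insert_remove) auto
    also have "(\<Prod>j \<in> ?keys m - {i}. (x(i := t)) j ^ ?lk m j) = (\<Prod>j \<in> ?keys m - {i}. x j ^ ?lk (rest m) j)"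
      by (rule prod.cong) (auto simp: lk_rest)
    also have "\<dots> = monom_value x (rest m)"
      by (rule monom_value_superset[symmetric]) (auto simp: in_keys_iff lk_rest split: if_splits)
    finally show ?thesis by (subst mult.commute)
  qed
  define E where "E = (\<lambda>m. ?lk m i) ` ?keys f"
  define p where "p = (\<Sum>k\<in>E. monom (rat_mpoly_eval x (c k)) k)"
  have "finite E" by (simp add: E_def)
  have coeff_p: "coeff p k = rat_mpoly_eval x (c k)" for k
  proof -
    have "c k = 0" if "k \<notin> E"
    proof -
      have "{m \<in> ?keys f. ?lk m i = k} = {}" using that by (auto simp: E_def)
      then show ?thesis by (simp only: c_def sum.empty)
    qed
    then show ?thesis
      using \<open>finite E\<close> by (auto simp: p_def coeff_sum sum.delta)
  qed
  have "rat_mpoly_eval (x(i := t)) f = (\<Sum>m \<in> ?keys f. of_rat (?lk f m) * monom_value x (rest m) * t ^ ?lk m i)"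
    by (simp add: rat_mpoly_eval_altdef monom_at mult_ac)
  also have "\<dots> = (\<Sum>k\<in>E. \<Sum>m \<in> {m \<in> ?keys f. ?lk m i = k}. of_rat (?lk f m) * monom_value x (rest m) * t ^ ?lk m i)"
    unfolding E_def by (rule sum.image_gen) simp
  also have "\<dots> = (\<Sum>k\<in>E. rat_mpoly_eval x (c k) * t ^ k)"
    by (intro sum.cong refl)
      (auto simp: c_def rat_mpoly_eval_sum rat_mpoly_eval_single sum_distrib_right intro!: sum.cong)
  also have "\<dots> = poly p t"
    by (simp add: p_def poly_sum poly_monom)
  finally have "poly p t = 0" using f(2) by simp
  then have "p = 0"
    using t[of p] c_in coeff_p by blast
  then have "c k = 0" for k
    using indep c_in[of k] coeff_p[of k] by (simp add: algebraically_independent_altdef)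
  then have "?lk f m = 0" for m
    using c_lookup[of m] by (auto simp: in_keys_iff)
  then show "f = 0"
    by (intro poly_mapping_eqI) simp
qed

text \<open>
  One coordinate is chosen after the other: only countably many values are roots of polynomials
  with coefficients in the countable ring generated by the earlier coordinates, and an interval is
  uncountable.
\<close>

lemma algebraically_independent_dense:
  fixes x0 :: "'v \<Rightarrow> real"
  assumes "finite I" "0 < \<epsilon>"
  shows "\<exists>x. algebraically_independent_over_rat I x \<and> (\<forall>i\<in>I. \<bar>x i - x0 i\<bar> < \<epsilon>)"
  using assms(1)
proof (induction I rule: finite_induct)
  case empty
  have "f = 0" if "mpoly_in {} f" "rat_mpoly_eval x0 f = 0" for f :: "('v \<Rightarrow>\<^sub>0 nat) \<Rightarrow>\<^sub>0 rat"
  proof -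
    have keys: "Poly_Mapping.keys f \<subseteq> {0}"
      using that(1) by (auto simp: mpoly_in_def)
    have "rat_mpoly_eval x0 f = of_rat (Poly_Mapping.lookup f 0)"
    proof (cases "Poly_Mapping.keys f = {}")
      case False
      with keys have "Poly_Mapping.keys f = {0}" by blast
      then show ?thesis by (simp add: rat_mpoly_eval_altdef monom_value_def)
    qed simp
    with that(2) have "Poly_Mapping.lookup f 0 = 0" by simp
    then have "0 \<notin> Poly_Mapping.keys f" by (simp add: in_keys_iff)
    with keys have "Poly_Mapping.keys f = {}" by blast
    then show ?thesis by simp
  qed
  then show ?case by (auto simp: algebraically_independent_altdef)
next
  case (insert i I)
  then obtain x where x: "algebraically_independent_over_rat I x" "\<forall>j\<in>I. \<bar>x j - x0 j\<bar> < \<epsilon>"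
    by blast
  define C where "C = rat_mpoly_eval x ` {g. mpoly_in I g}"
  have "countable C"
    unfolding C_def using insert.hyps by (intro countable_image countable_mpoly_in countable_finite)
  define P where "P = {p. set (coeffs p) \<subseteq> C}"
  have "coeffs ` P \<subseteq> lists C"
    by (auto simp: P_def)
  then have "countable (coeffs ` P)"
    using \<open>countable C\<close> by (metis countable_subset countable_lists)
  then have "countable P"
    by (rule countable_image_inj_on) (simp add: inj_on_def coeffs_eq_iff)
  define bad where "bad = (\<Union>p \<in> P - {0}. {t. poly p t = 0})"
  have "countable bad"
    unfolding bad_def using \<open>countable P\<close>
    by (intro countable_UN) (auto intro: countable_finite poly_roots_finite)
  moreover have "uncountable {x0 i - \<epsilon><..<x0 i + \<epsilon>}"
    using assms(2) by (simp add: uncountable_open_interval)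
  ultimately obtain t where t: "t \<in> {x0 i - \<epsilon><..<x0 i + \<epsilon>}" "t \<notin> bad"
    by (metis countable_subset subsetI)
  have "algebraically_independent_over_rat (insert i I) (x(i := t))"
  proof (rule algebraically_independent_extend[OF x(1) insert.hyps(2)])
    fix p :: "real poly"
    assume p: "p \<noteq> 0" "\<And>k. \<exists>g. mpoly_in I g \<and> coeff p k = rat_mpoly_eval x g"
    have "coeff p k \<in> C" for k
      using p(2)[of k] by (auto simp: C_def)
    then have "p \<in> P"
      by (auto simp: P_def coeffs_def)
    with p(1) t(2) show "poly p t \<noteq> 0" by (auto simp: bad_def)
  qed
  moreover have "\<forall>j\<in>insert i I. \<bar>(x(i := t)) j - x0 j\<bar> < \<epsilon>"
    using x(2) t(1) insert.hyps(2) by auto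
  ultimately show ?case by blast
qed

section \<open>Cycles and forests\<close>

lemma cycle_of_vertex_list:
  assumes G: "pair_graph G" and "vs \<noteq> []" "distinct vs"
    and path: "successively (\<lambda>v w. (v, w) \<in> parcs G) vs" and closed: "(last vs, hd vs) \<in> parcs G"
  shows "\<exists>c. pre_digraph.cycle (with_proj G) c \<and> length c = length vs"
proof -
  interpret pair_graph G by (rule G)
  let ?W = "with_proj G"
  have walk: "pre_digraph.cas ?W (hd ws) (zip ws (tl ws @ [z])) z \<and>
      pre_digraph.awalk_verts ?W u (zip ws (tl ws @ [z])) = ws @ [z] \<and>
      set (zip ws (tl ws @ [z])) \<subseteq> parcs G"
    if "ws \<noteq> []" "successively (\<lambda>v w. (v, w) \<in> parcs G) ws" "(last ws, z) \<in> parcs G" for ws z u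
    using that
  proof (induction ws arbitrary: u rule: induct_list012)
    case (3 a b ws)
    then show ?case by auto
  qed auto
  define c where "c = zip vs (tl vs @ [hd vs])"
  have "hd vs \<in> pverts G"
    using in_arcsD2[OF closed] by simp
  then have "pre_digraph.awalk ?W (hd vs) c (hd vs)"
    using walk[OF \<open>vs \<noteq> []\<close> path closed] by (simp add: pre_digraph.awalk_def c_def)
  moreover have "distinct (tl (pre_digraph.awalk_verts ?W (hd vs) c))"
    using walk[OF \<open>vs \<noteq> []\<close> path closed] \<open>distinct vs\<close> \<open>vs \<noteq> []\<close>
    by (cases vs) (auto simp: c_def)
  moreover have "length c = length vs" "c \<noteq> []"
    using \<open>vs \<noteq> []\<close> by (auto simp: c_def)
  ultimately show ?thesis
    unfolding pre_digraph.cycle_def by blast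
qed

text \<open>
  If every vertex had two neighbours in U, the first vertex of a longest path would have a
  neighbour further along the path, which closes a cycle.
\<close>

lemma forest_vertex_of_degree_at_most_one:
  assumes G: "pair_graph G" and forest: "forest_graph G" and U: "U \<subseteq> pverts G" "U \<noteq> {}"
  shows "\<exists>v\<in>U. \<forall>w\<in>U. \<forall>w'\<in>U. (v, w) \<in> parcs G \<longrightarrow> (v, w') \<in> parcs G \<longrightarrow> w = w'"
proof (rule ccontr)
  assume "\<not> ?thesis"
  then have branch: "\<exists>w\<in>U. \<exists>w'\<in>U. (v, w) \<in> parcs G \<and> (v, w') \<in> parcs G \<and> w \<noteq> w'" if "v \<in> U" for v
    using that by blast
  interpret pair_graph G by (rule G)
  have "finite U" using U(1) pair_finite_verts by (rule finite_subset)
  define P where "P p \<longleftrightarrow> p \<noteq> [] \<and> distinct p \<and> set p \<subseteq> U \<and> successively (\<lambda>v w. (v, w) \<in> parcs G) p" for p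
  have bound: "length p \<le> card U" if "P p" for p
    using that \<open>finite U\<close> by (metis P_def card_mono distinct_card)
  obtain u where "u \<in> U" using U(2) by blast
  then have "P [u]" by (simp add: P_def)
  then obtain p where p: "P p" and longest: "\<And>p'. P p' \<Longrightarrow> length p' \<le> length p"
    using ex_has_greatest_nat[of P "[u]" length "Suc (card U)"] bound by (metis le_imp_less_Suc)
  define second where "second = (if length p > 1 then p ! 1 else hd p)"
  have "hd p \<in> U" using p by (auto simp: P_def)
  \<comment> \<open>The first vertex has a neighbour other than its successor; it lies on the path by maximality.\<close>
  then obtain w where w: "w \<in> U" "(hd p, w) \<in> parcs G" "w \<noteq> second"
    using branch by metis
  have wh: "(w, hd p) \<in> parcs G" using w(2) by (simp add: arcs_symmetric)
  have "w \<in> set p"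
  proof (rule ccontr)
    assume "w \<notin> set p"
    then have "P (w # p)"
      using p w wh by (auto simp: P_def successively_Cons)
    from longest[OF this] show False by simp
  qed
  then obtain j where j: "j < length p" "p ! j = w"
    by (auto simp: in_set_conv_nth)
  have "w \<noteq> hd p" using w(2) no_loops' by auto
  then have "j \<noteq> 0" using j(2) p by (intro notI) (auto simp: P_def hd_conv_nth)
  moreover have "j \<noteq> 1" using j w(3) by (auto simp: second_def)
  ultimately have "2 \<le> j" by simp
  let ?vs = "take (Suc j) p"
  have "\<exists>c. pre_digraph.cycle (with_proj G) c \<and> length c = length ?vs"
  proof (rule cycle_of_vertex_list[OF G])
    show "?vs \<noteq> []" "distinct ?vs" using p by (auto simp: P_def)
    have "successively (\<lambda>v w. (v, w) \<in> parcs G) (?vs @ drop (Suc j) p)"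
      using p by (simp add: P_def)
    then show "successively (\<lambda>v w. (v, w) \<in> parcs G) ?vs"
      unfolding successively_append_iff by blast
    have "last ?vs = w" using j by (simp add: take_Suc_conv_app_nth)
    then show "(last ?vs, hd ?vs) \<in> parcs G" using wh by simp
  qed
  then show False
    using forest j(1) \<open>2 \<le> j\<close> unfolding forest_graph_def by force
qed

text \<open>
  A cycle as a periodic sequence, which can be read from any of its vertices.
\<close>

lemma cyclic_sequence_if_not_forest:
  assumes G: "pair_graph G" and "\<not> forest_graph G"
  shows "\<exists>(n::nat) f. 3 \<le> n \<and> (\<forall>i. (f i, f (Suc i)) \<in> parcs G) \<and> (\<forall>i j. f i = f j \<longleftrightarrow> i mod n = j mod n)"
proof -
  interpret pair_graph G by (rule G)
  obtain c u where len: "3 \<le> length c" and walk: "awalk u c u" and dist: "distinct (tl (awalk_verts u c))"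
    using assms(2) by (auto simp: forest_graph_def cycle_def)
  define n where "n = length c"
  have "c \<noteq> []" using len by auto
  have cas: "cas u c u" and sub: "set c \<subseteq> parcs G"
    using walk by (auto simp: awalk_def)
  have verts: "map fst c @ [snd (last c)] = fst (hd c) # map snd c"
    using awalk_verts_conv'[OF cas] awalk_verts_conv[of u c] \<open>c \<noteq> []\<close> by simp
  have "fst (hd c) = u" "snd (last c) = u"
    using awhd_if_cas[OF cas] awlast_if_cas[OF cas] awalk_verts_conv[of u c] \<open>c \<noteq> []\<close>
    by (auto simp: hd_map)
  have "distinct (map fst c)"
  proof -
    have "awalk_verts u c = map fst c @ [u]"
      using awalk_verts_conv[of u c] \<open>c \<noteq> []\<close> \<open>snd (last c) = u\<close> by simp
    then have "distinct (tl (map fst c) @ [u])"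
      using dist \<open>c \<noteq> []\<close> by simp
    moreover have "map fst c = u # tl (map fst c)"
      using \<open>c \<noteq> []\<close> \<open>fst (hd c) = u\<close> by (cases c) auto
    ultimately show ?thesis by (metis distinct.simps(2) distinct_append not_distinct_conv_prefix distinct1_rotate rotate1.simps(2))
  qed
  define f where "f i = fst (c ! (i mod n))" for i
  have "n > 0" using \<open>c \<noteq> []\<close> by (simp add: n_def)
  have snd_c: "snd (c ! i) = f (Suc i)" if "i < n" for i
  proof -
    have "snd (c ! i) = (map fst c @ [snd (last c)]) ! Suc i"
      using that unfolding verts by (simp add: n_def)
    also have "\<dots> = f (Suc i)"
    proof (cases "Suc i = n")
      case True
      then show ?thesis
        using \<open>fst (hd c) = u\<close> \<open>snd (last c) = u\<close> \<open>c \<noteq> []\<close>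
        by (simp add: f_def n_def nth_append hd_conv_nth)
    next
      case False
      with that show ?thesis by (simp add: f_def n_def nth_append)
    qed
    finally show ?thesis .
  qed
  have f_mod: "f (Suc (i mod n)) = f (Suc i)" for i
    by (simp add: f_def mod_Suc_eq)
  have "(f i, f (Suc i)) \<in> parcs G" for i
  proof -
    have "i mod n < n" using \<open>n > 0\<close> by simp
    then have "c ! (i mod n) = (f i, f (Suc i))"
      using snd_c[of "i mod n"] f_mod[of i] by (simp add: prod_eq_iff f_def)
    then show ?thesis
      using sub \<open>i mod n < n\<close> nth_mem[of "i mod n" c] by (auto simp: n_def)
  qed
  moreover have "f i = f j \<longleftrightarrow> i mod n = j mod n" for i j
    using nth_eq_iff_index_eq[OF \<open>distinct (map fst c)\<close>, of "i mod n" "j mod n"] \<open>n > 0\<close>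
    by (simp add: f_def n_def)
  ultimately show ?thesis using len n_def by blast
qed

section \<open>Sphere packings with two apexes and penny packings\<close>

lemma norm_real3_squared: "(norm x)\<^sup>2 = (x $ 1)\<^sup>2 + (x $ 2)\<^sup>2 + (x $ 3)\<^sup>2" for x :: "real ^ 3"
  by (simp add: norm_vec_def L2_set_def sum_3)

text \<open>
  The apexes have centres (0, 0, a) and (0, 0, -b) and touch at the origin; w is the squared
  distance of the third centre from the axis.
\<close>

lemma tangent_to_both_apexes_iff:
  fixes a b r w z :: real
  assumes "0 < a" "0 < b"
  shows "w + (z - a)\<^sup>2 = (r + a)\<^sup>2 \<and> w + (z + b)\<^sup>2 = (r + b)\<^sup>2 \<longleftrightarrow>
     z = r * ((b - a) / (a + b)) \<and> w = 4 * a * b / (a + b) * r + 4 * a * b / (a + b)\<^sup>2 * r\<^sup>2"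
    (is "?L \<longleftrightarrow> ?z \<and> ?w")
proof -
  have ab: "a + b \<noteq> 0" using assms by simp
  have w: "w + (z - a)\<^sup>2 = (r + a)\<^sup>2 \<longleftrightarrow> ?w" if ?z
  proof -
    have "(r + a)\<^sup>2 - (z - a)\<^sup>2 = 2 * a * (r + z) + (r + z) * (r - z)"
      by (simp add: power2_eq_square algebra_simps)
    moreover have "r + z = r * (2 * b / (a + b))" "r - z = r * (2 * a / (a + b))"
      unfolding that using ab by (simp_all add: field_simps)
    ultimately have "(r + a)\<^sup>2 - (z - a)\<^sup>2 = 4 * a * b / (a + b) * r + 4 * a * b / (a + b)\<^sup>2 * r\<^sup>2"
      by (simp add: power2_eq_square mult_ac)
    then show ?thesis by linarith
  qed
  have "w + (z + b)\<^sup>2 = (r + b)\<^sup>2 \<longleftrightarrow> ?z" if "w + (z - a)\<^sup>2 = (r + a)\<^sup>2"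
  proof -
    have "w + (z + b)\<^sup>2 = (r + b)\<^sup>2 \<longleftrightarrow> (z + b)\<^sup>2 - (z - a)\<^sup>2 = (r + b)\<^sup>2 - (r + a)\<^sup>2"
      using that by linarith
    also have "\<dots> \<longleftrightarrow> (a + b) * z = r * (b - a)"
      by (simp add: power2_eq_square algebra_simps) linarith
    also have "\<dots> \<longleftrightarrow> ?z"
      using ab by (auto simp: field_simps)
    finally show ?thesis .
  qed
  with w show ?thesis by blast
qed

text \<open>
  A sphere of radius r over the point q of the plane has its centre at (r q, r m). This is the
  coordinate form of the inversion at the point where the apexes touch: it maps the apexes to two
  parallel planes and all spheres between them to balls of equal radius, with centres in a common
  plane at (up to scaling) the points q.
\<close>

lemma scaled_distance:
  fixes q1 q2 :: complex and r1 r2 s \<kappa> m :: real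
  assumes "r1 \<noteq> 0" "r2 \<noteq> 0" and m: "m\<^sup>2 = 1 - \<kappa>"
    and q1: "(cmod q1)\<^sup>2 = s / r1 + \<kappa>" and q2: "(cmod q2)\<^sup>2 = s / r2 + \<kappa>"
  shows "(r1 * Re q1 - r2 * Re q2)\<^sup>2 + (r1 * Im q1 - r2 * Im q2)\<^sup>2 + (r1 * m - r2 * m)\<^sup>2 - (r1 + r2)\<^sup>2
    = r1 * r2 * ((cmod (q1 - q2))\<^sup>2 - 2\<^sup>2)"
proof -
  have s1: "r1 * (cmod q1)\<^sup>2 = s + \<kappa> * r1" and s2: "r2 * (cmod q2)\<^sup>2 = s + \<kappa> * r2"
    using assms by (simp_all add: field_simps)
  let ?c = "Re q1 * Re q2 + Im q1 * Im q2"
  have "(r1 * Re q1 - r2 * Re q2)\<^sup>2 + (r1 * Im q1 - r2 * Im q2)\<^sup>2 + (r1 * m - r2 * m)\<^sup>2 - (r1 + r2)\<^sup>2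
    = r1 * (r1 * (cmod q1)\<^sup>2) + r2 * (r2 * (cmod q2)\<^sup>2) - 2 * r1 * r2 * ?c + m\<^sup>2 * (r1 - r2)\<^sup>2 - (r1 + r2)\<^sup>2"
    unfolding cmod_power2 by (simp add: power2_eq_square algebra_simps)
  also have "\<dots> = r2 * (s + \<kappa> * r1) + r1 * (s + \<kappa> * r2) - r1 * r2 * (2 * ?c + 4)"
    unfolding s1 s2 m by (simp add: power2_eq_square algebra_simps)
  also have "\<dots> = r1 * r2 * ((cmod (q1 - q2))\<^sup>2 - 2\<^sup>2)"
    unfolding s1[symmetric] s2[symmetric] cmod_power2 by (simp add: power2_eq_square algebra_simps)
  finally show ?thesis .
qed

lemma pverts_join_K2 [simp]:
  "Inl v \<in> pverts (graph_join G K2) \<longleftrightarrow> v \<in> pverts G" "Inr c \<in> pverts (graph_join G K2)"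
  by (auto simp: graph_join_def K2_def)

lemma parcs_join_K2 [simp]:
  "(Inl v, Inl w) \<in> parcs (graph_join G K2) \<longleftrightarrow> (v, w) \<in> parcs G"
  "(Inl v, Inr c) \<in> parcs (graph_join G K2) \<longleftrightarrow> v \<in> pverts G"
  "(Inr c, Inl v) \<in> parcs (graph_join G K2) \<longleftrightarrow> v \<in> pverts G"
  "(Inr c, Inr d) \<in> parcs (graph_join G K2) \<longleftrightarrow> c \<noteq> d"
  by (auto simp: graph_join_def K2_def)

text \<open>
  Penny packings are described in the complex plane, where rotations and ratios of points are at
  hand.
\<close>

definition penny_position :: "'a pair_pre_digraph \<Rightarrow> ('a \<Rightarrow> complex) \<Rightarrow> bool" where
  "penny_position G q \<longleftrightarrow> (\<forall>v \<in> pverts G. \<forall>w \<in> pverts G. v \<noteq> w \<longrightarrow>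
     2 \<le> cmod (q v - q w) \<and> (cmod (q v - q w) = 2 \<longleftrightarrow> (v, w) \<in> parcs G))"

lemma penny_graph_iff_penny_position:
  "penny_graph G \<longleftrightarrow> pair_graph G \<and> (\<exists>q. penny_position G q)"
proof
  assume "penny_graph G"
  then obtain q :: "'a \<Rightarrow> real ^ 2" where G: "pair_graph G" and
    q: "\<forall>v \<in> pverts G. \<forall>w \<in> pverts G. v \<noteq> w \<longrightarrow>
        2 \<le> norm (q v - q w) \<and> (norm (q v - q w) = 2 \<longleftrightarrow> (v, w) \<in> parcs G)"
    unfolding penny_graph_def by blast
  have "norm (q v - q w) = cmod (Complex (q v $ 1) (q v $ 2) - Complex (q w $ 1) (q w $ 2))" for v w
    by (simp add: norm_vec_def L2_set_def sum_2 cmod_def)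
  with G q show "pair_graph G \<and> (\<exists>q. penny_position G q)"
    unfolding penny_position_def by (intro conjI exI[of _ "\<lambda>v. Complex (q v $ 1) (q v $ 2)"]) auto
next
  assume *: "pair_graph G \<and> (\<exists>q. penny_position G q)"
  then obtain q where q: "penny_position G q" by blast
  let ?q = "\<lambda>v. vector [Re (q v), Im (q v)] :: real ^ 2"
  have "norm (?q v - ?q w) = cmod (q v - q w)" for v w
    by (simp add: norm_vec_def L2_set_def sum_2 cmod_def)
  with * q show "penny_graph G"
    unfolding penny_graph_def penny_position_def by (intro conjI exI[of _ ?q]) auto
qed

text \<open>
  The radius r of the sphere over the point q, between two apexes of radii a and b, is determined
  by the distance of q from the origin.
\<close>

definition radius_relation :: "real \<Rightarrow> real \<Rightarrow> real \<Rightarrow> complex \<Rightarrow> bool" where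
  "radius_relation a b r q \<longleftrightarrow> (cmod q)\<^sup>2 = 4 * a * b / (a + b) / r + 4 * a * b / (a + b)\<^sup>2"

lemma apex_slope_squared:
  fixes a b :: real
  assumes "0 < a" "0 < b"
  shows "((b - a) / (a + b))\<^sup>2 = 1 - 4 * a * b / (a + b)\<^sup>2"
  using assms by (simp add: divide_simps) (simp add: power2_eq_square algebra_simps)

lemma le_and_eq_iff_by_squares:
  fixes x y x' y' c :: real
  assumes "0 \<le> x" "0 \<le> y" "0 \<le> x'" "0 \<le> y'" "0 < c" and "x\<^sup>2 - y\<^sup>2 = c * (x'\<^sup>2 - y'\<^sup>2)"
  shows "y \<le> x \<longleftrightarrow> y' \<le> x'" "x = y \<longleftrightarrow> x' = y'"
proof -
  have "y \<le> x \<longleftrightarrow> 0 \<le> x\<^sup>2 - y\<^sup>2"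
    using assms(1,2) by (simp add: power2_le_iff_abs_le)
  also have "\<dots> \<longleftrightarrow> 0 \<le> x'\<^sup>2 - y'\<^sup>2"
    unfolding assms(6) using assms(5) by (simp add: zero_le_mult_iff)
  also have "\<dots> \<longleftrightarrow> y' \<le> x'"
    using assms(3,4) by (simp add: power2_le_iff_abs_le)
  finally show "y \<le> x \<longleftrightarrow> y' \<le> x'" .
  have "x = y \<longleftrightarrow> x\<^sup>2 - y\<^sup>2 = 0"
    using assms(1,2) by (simp add: power2_eq_iff_nonneg)
  also have "\<dots> \<longleftrightarrow> x'\<^sup>2 - y'\<^sup>2 = 0"
    unfolding assms(6) using assms(5) by simp
  also have "\<dots> \<longleftrightarrow> x' = y'"
    using assms(3,4) by (simp add: power2_eq_iff_nonneg)
  finally show "x = y \<longleftrightarrow> x' = y'" .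
qed

text \<open>
  After a motion that puts the apexes into standard position, dividing the first two coordinates
  of the centres by the radii gives the points q, which form the penny packing.
\<close>

lemma penny_position_of_sphere_packing:
  assumes "sphere_packing (graph_join G K2) p r"
  shows "\<exists>q. penny_position G q \<and>
    (\<forall>v\<in>pverts G. radius_relation (r (Inr True)) (r (Inr False)) (r (Inl v)) (q v))"
proof -
  define a b where "a = r (Inr True)" and "b = r (Inr False)"
  define A B where "A = p (Inr True)" and "B = p (Inr False)"
  have pack: "norm (p x - p y) \<ge> r x + r y" "norm (p x - p y) = r x + r y \<longleftrightarrow> (x, y) \<in> parcs (graph_join G K2)"
    if "x \<in> pverts (graph_join G K2)" "y \<in> pverts (graph_join G K2)" "x \<noteq> y" for x y
    using assms that unfolding sphere_packing_def by blast+
  have pos: "0 < r x" if "x \<in> pverts (graph_join G K2)" for x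
    using assms that unfolding sphere_packing_def by blast
  have ab: "0 < a" "0 < b" using pos by (auto simp: a_def b_def)
  have AB: "norm (A - B) = a + b"
    using pack(2)[of "Inr True" "Inr False"] by (simp add: A_def B_def a_def b_def)
  \<comment> \<open>Move the point where the apex spheres touch to the origin and their centres to the third axis.\<close>
  define e where "e = (A - B) /\<^sub>R (a + b)"
  define T where "T = B + b *\<^sub>R e"
  have "norm e = 1" using AB ab by (simp add: e_def)
  then obtain f :: "real ^ 3 \<Rightarrow> real ^ 3" where f: "orthogonal_transformation f" "f e = axis 3 1"
    by (rule orthogonal_transformation_exists_1[OF _ norm_axis_1])
  define P where "P x = f (x - T)" for x
  have lin: "linear f" using f(1) by (rule orthogonal_transformation_linear)
  have P_dist: "norm (P x - P y) = norm (x - y)" for x y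
    using orthogonal_transformation_norm[OF f(1), of "x - y"]
    by (simp add: P_def linear_diff[OF lin, symmetric])
  have "(a + b) *\<^sub>R e = A - B" using ab by (simp add: e_def)
  then have "A - T = a *\<^sub>R e" "B - T = (- b) *\<^sub>R e"
    by (simp_all add: T_def algebra_simps)
  then have PA: "P A = a *\<^sub>R axis 3 1" and PB: "P B = (- b) *\<^sub>R axis 3 1"
    by (simp_all only: P_def linear_scale[OF lin] f(2))
  define \<rho> where "\<rho> v = r (Inl v)" for v
  define X where "X v = P (p (Inl v))" for v
  define m where "m = (b - a) / (a + b)"
  define q where "q v = Complex (X v $ 1 / \<rho> v) (X v $ 2 / \<rho> v)" for v
  have coords: "X v $ 3 = \<rho> v * m"
      "(X v $ 1)\<^sup>2 + (X v $ 2)\<^sup>2 = 4 * a * b / (a + b) * \<rho> v + 4 * a * b / (a + b)\<^sup>2 * (\<rho> v)\<^sup>2"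
    if v: "v \<in> pverts G" for v
  proof -
    have "norm (X v - P A) = \<rho> v + a" "norm (X v - P B) = \<rho> v + b"
      using pack(2)[of "Inl v" "Inr True"] pack(2)[of "Inl v" "Inr False"] v
      by (simp_all add: X_def P_dist A_def B_def a_def b_def \<rho>_def)
    then have "(norm (X v - P A))\<^sup>2 = (\<rho> v + a)\<^sup>2" "(norm (X v - P B))\<^sup>2 = (\<rho> v + b)\<^sup>2"
      by simp_all
    then have "(X v $ 1)\<^sup>2 + (X v $ 2)\<^sup>2 + (X v $ 3 - a)\<^sup>2 = (\<rho> v + a)\<^sup>2 \<and>
        (X v $ 1)\<^sup>2 + (X v $ 2)\<^sup>2 + (X v $ 3 + b)\<^sup>2 = (\<rho> v + b)\<^sup>2"
      by (simp add: norm_real3_squared PA PB axis_def)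
    then show "X v $ 3 = \<rho> v * m"
      "(X v $ 1)\<^sup>2 + (X v $ 2)\<^sup>2 = 4 * a * b / (a + b) * \<rho> v + 4 * a * b / (a + b)\<^sup>2 * (\<rho> v)\<^sup>2"
      using tangent_to_both_apexes_iff[OF ab] unfolding m_def by blast+
  qed
  have \<rho>_pos: "0 < \<rho> v" if "v \<in> pverts G" for v
    using pos that by (simp add: \<rho>_def)
  have rel: "radius_relation a b (\<rho> v) (q v)" if v: "v \<in> pverts G" for v
  proof -
    have "(cmod (q v))\<^sup>2 = ((X v $ 1)\<^sup>2 + (X v $ 2)\<^sup>2) / (\<rho> v)\<^sup>2"
      by (simp add: q_def cmod_power2 power_divide add_divide_distrib)
    also have "\<dots> = 4 * a * b / (a + b) / \<rho> v + 4 * a * b / (a + b)\<^sup>2"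
      unfolding coords(2)[OF v] using \<rho>_pos[OF v]
      by (simp add: add_divide_distrib) (simp add: power2_eq_square)
    finally show ?thesis by (simp add: radius_relation_def)
  qed
  have "2 \<le> cmod (q v - q w) \<and> (cmod (q v - q w) = 2 \<longleftrightarrow> (v, w) \<in> parcs G)"
    if v: "v \<in> pverts G" and w: "w \<in> pverts G" and "v \<noteq> w" for v w
  proof -
    have "X u $ 1 = \<rho> u * Re (q u)" "X u $ 2 = \<rho> u * Im (q u)" if "u \<in> pverts G" for u
      using \<rho>_pos[OF that] by (simp_all add: q_def)
    then have "(norm (X v - X w))\<^sup>2 - (\<rho> v + \<rho> w)\<^sup>2 = \<rho> v * \<rho> w * ((cmod (q v - q w))\<^sup>2 - 2\<^sup>2)"
      using scaled_distance[of "\<rho> v" "\<rho> w" m "4 * a * b / (a + b)\<^sup>2" "q v" "4 * a * b / (a + b)" "q w"]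
        rel[OF v] rel[OF w] \<rho>_pos[OF v] \<rho>_pos[OF w] coords(1) v w apex_slope_squared[OF ab]
      by (simp add: norm_real3_squared radius_relation_def m_def)
    moreover have "\<rho> v + \<rho> w \<le> norm (X v - X w)" "norm (X v - X w) = \<rho> v + \<rho> w \<longleftrightarrow> (v, w) \<in> parcs G"
      using pack[of "Inl v" "Inl w"] that by (simp_all add: X_def P_dist \<rho>_def)
    ultimately show ?thesis
      using le_and_eq_iff_by_squares[of "norm (X v - X w)" "\<rho> v + \<rho> w" "cmod (q v - q w)" 2 "\<rho> v * \<rho> w"]
        \<rho>_pos[OF v] \<rho>_pos[OF w] by simp
  qed
  with rel show ?thesis
    unfolding penny_position_def \<rho>_def a_def b_def by blast
qed

lemma sphere_packing_of_penny_position: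
  assumes G: "pair_graph G" and q: "penny_position G q"
    and pos: "0 < r (Inr True)" "0 < r (Inr False)" "\<And>v. v \<in> pverts G \<Longrightarrow> 0 < r (Inl v)"
    and rel: "\<And>v. v \<in> pverts G \<Longrightarrow> radius_relation (r (Inr True)) (r (Inr False)) (r (Inl v)) (q v)"
  shows "\<exists>p. sphere_packing (graph_join G K2) p r"
proof -
  interpret pair_graph G by (rule G)
  define a b where "a = r (Inr True)" and "b = r (Inr False)"
  define \<rho> where "\<rho> v = r (Inl v)" for v
  define m where "m = (b - a) / (a + b)"
  define p :: "'a + bool \<Rightarrow> real ^ 3" where
    "p x = (case x of Inl v \<Rightarrow> vector [\<rho> v * Re (q v), \<rho> v * Im (q v), \<rho> v * m]
      | Inr c \<Rightarrow> vector [0, 0, if c then a else - b])" for x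
  note pos = pos[folded a_def b_def \<rho>_def] and rel = rel[folded a_def b_def \<rho>_def]
  have apex: "norm (p (Inl v) - p (Inr c)) = r (Inl v) + r (Inr c)" if v: "v \<in> pverts G" for v c
  proof -
    have "(\<rho> v * Re (q v))\<^sup>2 + (\<rho> v * Im (q v))\<^sup>2 = (cmod (q v))\<^sup>2 * (\<rho> v)\<^sup>2"
      by (simp add: cmod_power2 power_mult_distrib algebra_simps)
    also have "\<dots> = 4 * a * b / (a + b) * \<rho> v + 4 * a * b / (a + b)\<^sup>2 * (\<rho> v)\<^sup>2"
    proof -
      have "(S / \<rho> v + K) * (\<rho> v)\<^sup>2 = S * \<rho> v + K * (\<rho> v)\<^sup>2" for S K
        using pos(3)[OF v] by (simp add: field_simps power2_eq_square)
      with rel[OF v] show ?thesis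
        unfolding radius_relation_def by (simp only:)
    qed
    finally have "(\<rho> v * Re (q v))\<^sup>2 + (\<rho> v * Im (q v))\<^sup>2 + (\<rho> v * m - a)\<^sup>2 = (\<rho> v + a)\<^sup>2 \<and>
        (\<rho> v * Re (q v))\<^sup>2 + (\<rho> v * Im (q v))\<^sup>2 + (\<rho> v * m + b)\<^sup>2 = (\<rho> v + b)\<^sup>2"
      using tangent_to_both_apexes_iff[OF pos(1,2)] m_def by blast
    then have "(norm (p (Inl v) - p (Inr c)))\<^sup>2 = (r (Inl v) + r (Inr c))\<^sup>2"
      by (cases c) (simp_all add: p_def norm_real3_squared \<rho>_def a_def b_def)
    moreover have "0 \<le> r (Inl v) + r (Inr c)"
      using pos(1,2) pos(3)[OF v] by (cases c) (simp_all add: a_def b_def \<rho>_def)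
    ultimately show ?thesis
      by (simp add: power2_eq_iff_nonneg)
  qed
  have base: "r (Inl v) + r (Inl w) \<le> norm (p (Inl v) - p (Inl w)) \<and>
      (norm (p (Inl v) - p (Inl w)) = r (Inl v) + r (Inl w) \<longleftrightarrow> (v, w) \<in> parcs G)"
    if v: "v \<in> pverts G" and w: "w \<in> pverts G" and "v \<noteq> w" for v w
  proof -
    have "(norm (p (Inl v) - p (Inl w)))\<^sup>2 - (\<rho> v + \<rho> w)\<^sup>2 = \<rho> v * \<rho> w * ((cmod (q v - q w))\<^sup>2 - 2\<^sup>2)"
      using scaled_distance[of "\<rho> v" "\<rho> w" m "4 * a * b / (a + b)\<^sup>2" "q v" "4 * a * b / (a + b)" "q w"]
        rel[OF v] rel[OF w] pos(3)[OF v] pos(3)[OF w] apex_slope_squared[OF pos(1,2)]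
      by (simp add: norm_real3_squared radius_relation_def m_def p_def)
    moreover have "2 \<le> cmod (q v - q w)" "cmod (q v - q w) = 2 \<longleftrightarrow> (v, w) \<in> parcs G"
      using q that unfolding penny_position_def by blast+
    ultimately show ?thesis
      using le_and_eq_iff_by_squares[of "norm (p (Inl v) - p (Inl w))" "\<rho> v + \<rho> w" "cmod (q v - q w)" 2 "\<rho> v * \<rho> w"]
        pos(3)[OF v] pos(3)[OF w] by (simp add: \<rho>_def)
  qed
  have apexes: "norm (p (Inr c) - p (Inr d)) = r (Inr c) + r (Inr d)" if "c \<noteq> d" for c d
  proof -
    have "(norm (p (Inr c) - p (Inr d)))\<^sup>2 = (a + b)\<^sup>2"
      using that by (cases c; cases d) (simp_all add: p_def norm_real3_squared power2_commute[of _ a])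
    then have "norm (p (Inr c) - p (Inr d)) = a + b"
      using pos(1,2) by (simp add: power2_eq_iff_nonneg)
    then show ?thesis
      using that by (cases c; cases d) (simp_all add: a_def b_def)
  qed
  have "0 < r x" if "x \<in> pverts (graph_join G K2)" for x
  proof (cases x)
    case (Inl v)
    then show ?thesis using that pos(3)[of v] by (simp add: \<rho>_def)
  next
    case (Inr c)
    then show ?thesis using pos(1,2) by (cases c) (simp_all add: a_def b_def)
  qed
  moreover have "r x + r y \<le> norm (p x - p y) \<and>
      (norm (p x - p y) = r x + r y \<longleftrightarrow> (x, y) \<in> parcs (graph_join G K2))"
    if "x \<in> pverts (graph_join G K2)" "y \<in> pverts (graph_join G K2)" "x \<noteq> y" for x y
  proof -
    have apex': "norm (p (Inr c) - p (Inl v)) = r (Inr c) + r (Inl v)" if "v \<in> pverts G" for v c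
      using apex[OF that, of c] by (simp add: norm_minus_commute add.commute)
    show ?thesis
      using that base apex apex' apexes by (cases x; cases y) auto
  qed
  ultimately have "sphere_packing (graph_join G K2) p r"
    unfolding sphere_packing_def using pair_graph_graph_join[OF G pair_graph_K2] by blast
  then show ?thesis by blast
qed

section \<open>Generic radii exclude cycles\<close>

text \<open>
  Here h is half the derivative of the squared distance of q from the origin and tau / |q|^2 is
  the angular velocity of q. Deriving |q - q'|^2 = 4 in polar coordinates shows that the radial
  velocities determine the difference of the angular ones, unless the edge points at the origin.
\<close>

lemma edge_derivative:
  assumes D: "derivation D" and edge: "(cmod (q - q'))\<^sup>2 = 4"
    and dN: "Re q * D (Re q) + Im q * D (Im q) = h" "Re q' * D (Re q') + Im q' * D (Im q') = h'"
  defines "\<tau> \<equiv> Re q * D (Im q) - Im q * D (Re q)" and "\<tau>' \<equiv> Re q' * D (Im q') - Im q' * D (Re q')"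
    and "dot \<equiv> Re q * Re q' + Im q * Im q'" and "cross \<equiv> Re q * Im q' - Im q * Re q'"
  shows "cross * (\<tau> * (cmod q')\<^sup>2 - \<tau>' * (cmod q)\<^sup>2) =
    h * ((cmod q)\<^sup>2 - dot) * (cmod q')\<^sup>2 + h' * ((cmod q')\<^sup>2 - dot) * (cmod q)\<^sup>2"
proof -
  have "(Re q - Re q')\<^sup>2 + (Im q - Im q')\<^sup>2 = 4"
    using edge by (simp add: cmod_power2)
  then have "D ((Re q - Re q')\<^sup>2 + (Im q - Im q')\<^sup>2) = 0"
    using D by simp
  then have "(Re q - Re q') * (D (Re q) - D (Re q')) + (Im q - Im q') * (D (Im q) - D (Im q')) = 0"
    by (simp add: derivation_add[OF D] derivation_power2[OF D] derivation_diff[OF D] algebra_simps)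
  then have e: "Re q' * D (Re q) + Im q' * D (Im q) + Re q * D (Re q') + Im q * D (Im q') = h + h'"
    unfolding dN[symmetric] by (simp add: algebra_simps)
  have "(Re q' * D (Re q) + Im q' * D (Im q)) * (cmod q)\<^sup>2 = h * dot + \<tau> * cross"
    unfolding dN[symmetric] \<tau>_def dot_def cross_def cmod_power2
    by (simp add: power2_eq_square algebra_simps)
  moreover have "(Re q * D (Re q') + Im q * D (Im q')) * (cmod q')\<^sup>2 = h' * dot - \<tau>' * cross"
    unfolding dN[symmetric] \<tau>'_def dot_def cross_def cmod_power2
    by (simp add: power2_eq_square algebra_simps)
  moreover have "(Re q' * D (Re q) + Im q' * D (Im q)) * (cmod q)\<^sup>2 * (cmod q')\<^sup>2 +
      (Re q * D (Re q') + Im q * D (Im q')) * (cmod q')\<^sup>2 * (cmod q)\<^sup>2 = (h + h') * (cmod q)\<^sup>2 * (cmod q')\<^sup>2"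
    unfolding e[symmetric] by (simp add: algebra_simps)
  ultimately have "(h * dot + \<tau> * cross) * (cmod q')\<^sup>2 + (h' * dot - \<tau>' * cross) * (cmod q)\<^sup>2
      = (h + h') * (cmod q)\<^sup>2 * (cmod q')\<^sup>2"
    by simp
  then show ?thesis by (simp add: algebra_simps)
qed

lemma dot_cross_squared:
  "(Re q * Re q' + Im q * Im q')\<^sup>2 + (Re q * Im q' - Im q * Re q')\<^sup>2 = (cmod q)\<^sup>2 * (cmod q')\<^sup>2"
  unfolding cmod_power2 by (simp add: power2_eq_square algebra_simps)

lemma cmod_diff_squared:
  "(cmod (q - q'))\<^sup>2 = (cmod q)\<^sup>2 + (cmod q')\<^sup>2 - 2 * (Re q * Re q' + Im q * Im q')"
  unfolding cmod_power2 by (simp add: power2_eq_square algebra_simps)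

text \<open>
  A derivation that moves the radius of the sphere k and no other radius moves the distance of q k
  from the origin and keeps the distances of all other points from it, because a and b, hence the
  two coefficients in the radius relation, have derivative zero.
\<close>

lemma radius_derivation:
  assumes gen: "generic_radii (graph_join G K2) r"
    and pos: "\<And>x. x \<in> pverts (graph_join G K2) \<Longrightarrow> 0 < r x"
    and rel: "\<And>v. v \<in> pverts G \<Longrightarrow> radius_relation (r (Inr True)) (r (Inr False)) (r (Inl v)) (q v)"
    and k: "k \<in> pverts G"
  obtains D h where "derivation D" "h \<noteq> 0"
    "\<And>v. v \<in> pverts G \<Longrightarrow> Re (q v) * D (Re (q v)) + Im (q v) * D (Im (q v)) = (if v = k then h else 0)"
proof -
  let ?d = "\<lambda>x. if x = Inl k then 1 else 0"
  obtain D where D: "derivation D"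
    and Dr: "\<And>x. x \<in> pverts (graph_join G K2) \<Longrightarrow> D (r x) = ?d x"
    using derivation_with_prescribed_values[OF gen[unfolded generic_radii_def], of ?d] by blast
  define a b where "a = r (Inr True)" and "b = r (Inr False)"
  have ab: "0 < a" "0 < b" "D a = 0" "D b = 0"
    using pos Dr by (simp_all add: a_def b_def)
  define s where "s = 4 * a * b / (a + b)"
  define \<kappa> where "\<kappa> = 4 * a * b / (a + b)\<^sup>2"
  have "D s = 0" "D \<kappa> = 0"
    using ab D by (simp_all add: s_def \<kappa>_def derivation_divide derivation_mult derivation_add derivation_power2)
  have "s > 0" using ab by (simp add: s_def)
  define h where "h = - s / (2 * (r (Inl k))\<^sup>2)"
  have "Re (q v) * D (Re (q v)) + Im (q v) * D (Im (q v)) = (if v = k then h else 0)" if v: "v \<in> pverts G" for v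
  proof -
    have rv: "r (Inl v) > 0" using pos v by simp
    have "(Re (q v))\<^sup>2 + (Im (q v))\<^sup>2 = s / r (Inl v) + \<kappa>"
      using rel[OF v] by (simp add: radius_relation_def cmod_power2 s_def \<kappa>_def a_def b_def)
    then have "D ((Re (q v))\<^sup>2 + (Im (q v))\<^sup>2) = D (s / r (Inl v) + \<kappa>)" by simp
    then have "2 * (Re (q v) * D (Re (q v)) + Im (q v) * D (Im (q v))) = - s * D (r (Inl v)) / (r (Inl v))\<^sup>2"
      using rv \<open>D s = 0\<close> \<open>D \<kappa> = 0\<close>
      by (simp add: derivation_add[OF D] derivation_power2[OF D] derivation_divide[OF D] algebra_simps)
    also have "\<dots> = 2 * (if v = k then h else 0)"
      using v Dr[of "Inl v"] by (simp add: h_def)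
    finally show ?thesis by simp
  qed
  moreover have "h \<noteq> 0"
    using \<open>s > 0\<close> pos[of "Inl k"] k by (simp add: h_def)
  ultimately show ?thesis using that D by blast
qed

lemma opposite_if_perpendicular_to_same:
  fixes x1 y1 x2 y2 X Y c :: real
  assumes p1: "x1 * X + y1 * Y = 0" and p2: "x2 * X + y2 * Y = 0" and XY: "X\<^sup>2 + Y\<^sup>2 > 0"
    and l1: "x1\<^sup>2 + y1\<^sup>2 = c" and l2: "x2\<^sup>2 + y2\<^sup>2 = c" and "x1 \<noteq> x2 \<or> y1 \<noteq> y2"
  shows "x1 = - x2 \<and> y1 = - y2"
proof -
  have "(x1 * y2 - x2 * y1) * X = y2 * (x1 * X + y1 * Y) - y1 * (x2 * X + y2 * Y)"
    "(x1 * y2 - x2 * y1) * Y = x1 * (x2 * X + y2 * Y) - x2 * (x1 * X + y1 * Y)"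
    by (simp_all add: algebra_simps)
  then have c0: "x1 * y2 - x2 * y1 = 0"
    using p1 p2 XY by auto
  have "((x1 - x2)\<^sup>2 + (y1 - y2)\<^sup>2) * ((x1 + x2)\<^sup>2 + (y1 + y2)\<^sup>2)
      = ((x1\<^sup>2 + y1\<^sup>2) - (x2\<^sup>2 + y2\<^sup>2))\<^sup>2 + 4 * (x1 * y2 - x2 * y1)\<^sup>2"
    by (simp add: power2_eq_square algebra_simps)
  also have "\<dots> = 0"
    using l1 l2 c0 by simp
  finally have "x1 - x2 = 0 \<and> y1 - y2 = 0 \<or> x1 + x2 = 0 \<and> y1 + y2 = 0"
    by (simp only: mult_eq_0_iff sum_power2_eq_zero_iff)
  with assms(6) show ?thesis by (auto simp: add_eq_0_iff2)
qed

text \<open>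
  Move only the radius of the vertex k of a cycle. Along the rest of the cycle the points keep
  their distances to the origin and to their successors, so they all rotate with the same angular
  velocity. For the two edges at k this leaves the same linear condition on both edge vectors,
  which are therefore opposite: k is the midpoint of its neighbours. This is absurd if k is a
  point of the cycle farthest from the origin.
\<close>

lemma forest_of_generic_sphere_packing:
  assumes G: "pair_graph G" and pack: "sphere_packing (graph_join G K2) p r"
    and gen: "generic_radii (graph_join G K2) r"
  shows "forest_graph G"
proof (rule ccontr)
  assume "\<not> forest_graph G"
  then obtain n f where n: "3 \<le> (n::nat)" and adj: "\<And>i. (f i, f (Suc i)) \<in> parcs G"
    and f_eq: "\<And>i j. f i = f j \<longleftrightarrow> i mod n = j mod n"
    using cyclic_sequence_if_not_forest[OF G] by blast
  interpret pair_graph G by (rule G)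
  obtain q where q: "penny_position G q"
    and rel: "\<And>v. v \<in> pverts G \<Longrightarrow> radius_relation (r (Inr True)) (r (Inr False)) (r (Inl v)) (q v)"
    using penny_position_of_sphere_packing[OF pack] by blast
  have pos: "0 < r x" if "x \<in> pverts (graph_join G K2)" for x
    using pack that unfolding sphere_packing_def by blast
  have f_in: "f i \<in> pverts G" for i
    using in_arcsD1[OF adj] by simp
  have edge: "(cmod (q v - q w))\<^sup>2 = 4" if "(v, w) \<in> parcs G" for v w
  proof -
    have "v \<in> pverts G" "w \<in> pverts G" "v \<noteq> w"
      using that no_loops' by (auto dest: in_arcsD1 in_arcsD2)
    then have "cmod (q v - q w) = 2"
      using q that unfolding penny_position_def by blast
    then show ?thesis by simp
  qed
  define N where "N v = (cmod (q v))\<^sup>2" for v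
  define dot where "dot v w = Re (q v) * Re (q w) + Im (q v) * Im (q w)" for v w
  define cross where "cross v w = Re (q v) * Im (q w) - Im (q v) * Re (q w)" for v w
  have N_edge: "N v + N w - 2 * dot v w = 4" if "(v, w) \<in> parcs G" for v w
    using edge[OF that] cmod_diff_squared[of "q v" "q w"] by (simp add: N_def dot_def)
  have N_pos: "0 < N v" if "v \<in> pverts G" for v
    using rel[OF that] pos[of "Inl v"] pos[of "Inr True"] pos[of "Inr False"] that
    unfolding N_def radius_relation_def by (simp add: add_pos_pos)

  \<comment> \<open>The origin lies on no line through two touching pennies: changing the radius of one end alone
    would otherwise change the length of the edge.\<close>
  have cross_nz: "cross v w \<noteq> 0" if vw: "(v, w) \<in> parcs G" for v w
  proof
    assume c0: "cross v w = 0"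
    have in_G: "v \<in> pverts G" "w \<in> pverts G" "w \<noteq> v"
      using vw no_loops' by (auto dest: in_arcsD1 in_arcsD2)
    obtain D h where D: "derivation D" "h \<noteq> 0"
      and h: "\<And>u. u \<in> pverts G \<Longrightarrow> Re (q u) * D (Re (q u)) + Im (q u) * D (Im (q u)) = (if u = v then h else 0)"
      using radius_derivation[OF gen pos rel in_G(1)] by metis
    have "h * (N v - dot v w) * N w = 0"
      using edge_derivative[OF D(1) edge[OF vw] h[OF in_G(1)] h[OF in_G(2)]] in_G(3) c0
      by (simp add: N_def dot_def cross_def)
    then have "N v = dot v w"
      using D(2) N_pos[OF in_G(2)] by simp
    moreover have "(dot v w)\<^sup>2 = N v * N w"
      using dot_cross_squared[of "q v" "q w"] c0 by (simp add: N_def dot_def cross_def)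
    ultimately have "N w = N v"
      using N_pos[OF in_G(1)] by (simp add: power2_eq_square)
    then show False
      using N_edge[OF vw] \<open>N v = dot v w\<close> by simp
  qed

  \<comment> \<open>A vertex of the cycle that is farthest from the origin.\<close>
  obtain k where max: "\<And>i. N (f i) \<le> N (f k)"
  proof -
    have fin: "finite (range (\<lambda>i. N (f i)))"
      by (rule finite_subset[of _ "N ` pverts G"]) (use f_in in auto)
    then have "Max (range (\<lambda>i. N (f i))) \<in> range (\<lambda>i. N (f i))"
      by (intro Max_in) auto
    then obtain k where "Max (range (\<lambda>i. N (f i))) = N (f k)" by auto
    with fin that[of k] show ?thesis
      by (metis Max_ge rangeI)
  qed
  obtain D h where D: "derivation D" "h \<noteq> 0"
    and h: "\<And>u. u \<in> pverts G \<Longrightarrow> Re (q u) * D (Re (q u)) + Im (q u) * D (Im (q u)) = (if u = f k then h else 0)"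
    using radius_derivation[OF gen pos rel f_in[of k]] by metis
  define \<theta> where "\<theta> v = (Re (q v) * D (Im (q v)) - Im (q v) * D (Re (q v))) / N v" for v
  have ang: "cross v w * (\<theta> v - \<theta> w) * (N v * N w) =
      (if v = f k then h else 0) * (N v - dot v w) * N w + (if w = f k then h else 0) * (N w - dot v w) * N v"
    if vw: "(v, w) \<in> parcs G" for v w
  proof -
    have in_G: "v \<in> pverts G" "w \<in> pverts G"
      using vw by (auto dest: in_arcsD1 in_arcsD2)
    have "(\<theta> v - \<theta> w) * (N v * N w) =
        (Re (q v) * D (Im (q v)) - Im (q v) * D (Re (q v))) * N w - (Re (q w) * D (Im (q w)) - Im (q w) * D (Re (q w))) * N v"
      using N_pos[OF in_G(1)] N_pos[OF in_G(2)] by (simp add: \<theta>_def field_simps)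
    then show ?thesis
      using edge_derivative[OF D(1) edge[OF vw] h[OF in_G(1)] h[OF in_G(2)]]
      by (simp add: N_def dot_def cross_def mult.assoc)
  qed
  have \<theta>_const: "\<theta> (f (k + 1 + i)) = \<theta> (f (k + 1))" if "i \<le> n - 2" for i
    using that
  proof (induction i)
    case (Suc i)
    have "f (k + 1 + i) \<noteq> f k" "f (k + 1 + Suc i) \<noteq> f k"
    proof -
      have "\<not> n dvd (1 + i)" "\<not> n dvd (2 + i)"
        using Suc.prems n by (auto dest: dvd_imp_le)
      moreover have "(k + j) mod n = k mod n \<longleftrightarrow> n dvd j" for j
        by (metis add_diff_cancel_left' le_add1 mod_eq_dvd_iff_nat)
      ultimately show "f (k + 1 + i) \<noteq> f k" "f (k + 1 + Suc i) \<noteq> f k"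
        unfolding f_eq by (metis add.assoc, metis add.assoc add_Suc_right add_Suc one_add_one plus_1_eq_Suc)
    qed
    then have "\<theta> (f (k + 1 + i)) = \<theta> (f (Suc (k + 1 + i)))"
      using ang[OF adj[of "k + 1 + i"]] cross_nz[OF adj[of "k + 1 + i"]] N_pos[OF f_in[of "k + 1 + i"]]
        N_pos[OF f_in[of "Suc (k + 1 + i)"]]
      by simp
    with Suc show ?case by simp
  qed simp
  define u w where "u = f (k + 1)" and "w = f (k + 1 + (n - 2))"
  have w_next: "f (Suc (k + 1 + (n - 2))) = f k"
  proof -
    have "Suc (k + 1 + (n - 2)) = k + n" using n by simp
    then show ?thesis by (simp only: f_eq mod_add_self2)
  qed
  have ku: "(f k, u) \<in> parcs G" using adj[of k] by (simp add: u_def)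
  have "(w, f k) \<in> parcs G"
    using adj[of "k + 1 + (n - 2)"] by (simp only: w_def w_next)
  then have kw: "(f k, w) \<in> parcs G" by (simp add: arcs_symmetric)
  have "\<theta> w = \<theta> u" using \<theta>_const[of "n - 2"] by (simp add: u_def w_def)
  have "u \<noteq> w"
  proof -
    have "\<not> n dvd (n - 2)" using n by (auto dest: dvd_imp_le)
    then show ?thesis
      unfolding u_def w_def f_eq by (metis add_diff_cancel_left' le_add1 mod_eq_dvd_iff_nat)
  qed
  \<comment> \<open>Both edges at k are perpendicular to the same nonzero vector, so k is the midpoint of u and w.\<close>
  define \<Theta> where "\<Theta> = \<theta> (f k) - \<theta> u"
  define g where "g = h / N (f k)"
  define X Y where "X = - \<Theta> * Im (q (f k)) + g * Re (q (f k))"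
    and "Y = \<Theta> * Re (q (f k)) + g * Im (q (f k))"
  have normal: "(Re (q x) - Re (q (f k))) * X + (Im (q x) - Im (q (f k))) * Y = 0"
    if x: "(f k, x) \<in> parcs G" "\<theta> x = \<theta> u" for x
  proof -
    have "x \<noteq> f k" "x \<in> pverts G" using x(1) no_loops' by (auto dest: in_arcsD2)
    then have "cross (f k) x * \<Theta> * N (f k) = h * (N (f k) - dot (f k) x)"
      using ang[OF x(1)] x(2) N_pos[of x] by (simp add: \<Theta>_def)
    then have "cross (f k) x * \<Theta> + g * (dot (f k) x - N (f k)) = 0"
      using N_pos[OF f_in[of k]] by (simp add: g_def field_simps)
    moreover have "N (f k) = (Re (q (f k)))\<^sup>2 + (Im (q (f k)))\<^sup>2"
      by (simp add: N_def cmod_power2)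
    ultimately show ?thesis
      unfolding X_def Y_def cross_def dot_def by (simp add: power2_eq_square algebra_simps)
  qed
  have XY: "X\<^sup>2 + Y\<^sup>2 > 0"
  proof -
    have "X\<^sup>2 + Y\<^sup>2 = (\<Theta>\<^sup>2 + g\<^sup>2) * N (f k)"
      unfolding X_def Y_def N_def cmod_power2 by (simp add: power2_eq_square algebra_simps)
    moreover have "g \<noteq> 0" using D(2) N_pos[OF f_in[of k]] by (simp add: g_def)
    ultimately show ?thesis
      using N_pos[OF f_in[of k]] by (simp add: sum_power2_gt_zero_iff)
  qed
  define x1 y1 where "x1 = Re (q u) - Re (q (f k))" and "y1 = Im (q u) - Im (q (f k))"
  define x2 y2 where "x2 = Re (q w) - Re (q (f k))" and "y2 = Im (q w) - Im (q (f k))"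
  have len: "x1\<^sup>2 + y1\<^sup>2 = 4" "x2\<^sup>2 + y2\<^sup>2 = 4"
    using edge[OF ku] edge[OF kw] by (simp_all add: cmod_power2 x1_def y1_def x2_def y2_def power2_commute)
  have "x1 = - x2 \<and> y1 = - y2"
  proof (rule opposite_if_perpendicular_to_same[OF _ _ XY len])
    show "x1 * X + y1 * Y = 0" "x2 * X + y2 * Y = 0"
      using normal[OF ku] normal[OF kw] \<open>\<theta> w = \<theta> u\<close> by (simp_all add: x1_def y1_def x2_def y2_def)
    have "u \<in> pverts G" "w \<in> pverts G"
      using ku kw by (auto dest: in_arcsD2)
    then have "q u \<noteq> q w"
      using q \<open>u \<noteq> w\<close> unfolding penny_position_def by force
    then show "x1 \<noteq> x2 \<or> y1 \<noteq> y2"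
      by (auto simp: x1_def y1_def x2_def y2_def complex_eq_iff)
  qed
  then have "Re (q u) + Re (q w) = 2 * Re (q (f k))" "Im (q u) + Im (q w) = 2 * Im (q (f k))"
    by (simp_all add: x1_def y1_def x2_def y2_def)
  moreover have "dot (f k) u + dot (f k) w =
      Re (q (f k)) * (Re (q u) + Re (q w)) + Im (q (f k)) * (Im (q u) + Im (q w))"
    unfolding dot_def by (simp add: algebra_simps)
  ultimately have "dot (f k) u + dot (f k) w = 2 * N (f k)"
    unfolding N_def cmod_power2 by (simp add: power2_eq_square)
  then have "N u + N w = 2 * N (f k) + 8"
    using N_edge[OF ku] N_edge[OF kw] by simp
  moreover have "N u \<le> N (f k)" "N w \<le> N (f k)"
    using max unfolding u_def w_def by blast+
  ultimately show False by simp
qed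

section \<open>Stresses of generic packings\<close>

text \<open>
  A derivation applied to the coordinates of the centres is an infinitesimal motion that realises
  the change D r of the radii.
\<close>

lemma norm_diff_derivative:
  fixes p p' :: "real ^ 3"
  assumes D: "derivation D" and dist: "norm (p - p') = r + r'"
  shows "(p - p') \<bullet> ((\<chi> i. D (p $ i)) - (\<chi> i. D (p' $ i))) = (r + r') * (D r + D r')"
proof -
  have "(p $ 1 - p' $ 1)\<^sup>2 + (p $ 2 - p' $ 2)\<^sup>2 + (p $ 3 - p' $ 3)\<^sup>2 = (r + r')\<^sup>2"
    using norm_real3_squared[of "p - p'"] dist by simp
  then have "D ((p $ 1 - p' $ 1)\<^sup>2 + (p $ 2 - p' $ 2)\<^sup>2 + (p $ 3 - p' $ 3)\<^sup>2) = D ((r + r')\<^sup>2)"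
    by simp
  then show ?thesis
    by (simp add: derivation_add[OF D] derivation_power2[OF D] derivation_diff[OF D]
        inner_vec_def sum_3 algebra_simps)
qed

text \<open>
  A stress is orthogonal to the edge-length changes of every infinitesimal motion. In a generic
  packing every change of the radii comes from a motion, so the stress also balances the lengths
  r v + r w. It suffices to test this on the change of radii c, which is the imbalance itself: the
  sum of its squares is zero.
\<close>

lemma stress_radius_equation:
  assumes pack: "sphere_packing H p r" and gen: "generic_radii H r"
    and stress: "equilibrium_stress H p \<sigma>" and "v \<in> pverts H"
  shows "(\<Sum>w \<in> {w. (v, w) \<in> parcs H}. \<sigma> {v, w} * (r v + r w)) = 0"
proof -
  interpret pair_graph H using pack by (simp add: sphere_packing_def)
  define V where "V = pverts H"
  have "finite V" by (simp add: V_def)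
  define \<omega> where "\<omega> v w = (if (v, w) \<in> parcs H then \<sigma> {v, w} else 0)" for v w
  have \<omega>_sym: "\<omega> v w = \<omega> w v" for v w
    by (simp add: \<omega>_def insert_commute arcs_symmetric)
  have nbrs: "(\<Sum>w \<in> {w. (v, w) \<in> parcs H}. \<sigma> {v, w} *\<^sub>R g w) = (\<Sum>w\<in>V. \<omega> v w *\<^sub>R g w)"
    for v and g :: "'a \<Rightarrow> 'b::real_vector"
    by (rule sum.mono_neutral_cong_left) (use \<open>finite V\<close> in \<open>auto simp: \<omega>_def V_def dest: in_arcsD2\<close>)
  define c where "c v = (\<Sum>w\<in>V. \<omega> v w * (r v + r w))" for v
  obtain D where D: "derivation D" and Dr: "\<And>v. v \<in> V \<Longrightarrow> D (r v) = c v"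
    using derivation_with_prescribed_values[OF gen[unfolded generic_radii_def], of c]
    unfolding V_def by blast
  define dp where "dp v = (\<chi> i. D (p v $ i))" for v
  have edge: "\<omega> v w * ((p v - p w) \<bullet> (dp v - dp w)) = \<omega> v w * ((r v + r w) * (c v + c w))"
    if "v \<in> V" "w \<in> V" for v w
  proof (cases "(v, w) \<in> parcs H")
    case True
    then have "norm (p v - p w) = r v + r w"
      using pack that no_loops' unfolding sphere_packing_def V_def by blast
    from norm_diff_derivative[OF D this] that show ?thesis
      by (simp add: dp_def Dr)
  qed (simp add: \<omega>_def)
  \<comment> \<open>An equilibrium stress annihilates every motion, in particular the one that realises dr = c.\<close>
  have swap: "(\<Sum>v\<in>V. \<Sum>w\<in>V. \<omega> v w * F v w) = (\<Sum>v\<in>V. \<Sum>w\<in>V. \<omega> v w * F w v)" for F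
    by (subst sum.swap) (simp add: \<omega>_sym)
  have "0 = (\<Sum>v\<in>V. (\<Sum>w\<in>V. \<omega> v w *\<^sub>R (p v - p w)) \<bullet> dp v)"
    using stress by (simp add: equilibrium_stress_def nbrs V_def)
  also have "\<dots> = (\<Sum>v\<in>V. \<Sum>w\<in>V. \<omega> v w * ((p v - p w) \<bullet> dp v))"
    by (simp add: inner_sum_left)
  finally have "0 = (\<Sum>v\<in>V. \<Sum>w\<in>V. \<omega> v w * ((p v - p w) \<bullet> dp v)) + (\<Sum>v\<in>V. \<Sum>w\<in>V. \<omega> v w * ((p w - p v) \<bullet> dp w))"
    using swap[of "\<lambda>v w. (p v - p w) \<bullet> dp v"] by simp
  also have "\<dots> = (\<Sum>v\<in>V. \<Sum>w\<in>V. \<omega> v w * ((p v - p w) \<bullet> (dp v - dp w)))"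
    by (simp add: sum.distrib[symmetric] algebra_simps)
  also have "\<dots> = (\<Sum>v\<in>V. \<Sum>w\<in>V. \<omega> v w * ((r v + r w) * c v)) + (\<Sum>v\<in>V. \<Sum>w\<in>V. \<omega> v w * ((r w + r v) * c w))"
  proof -
    have "(\<Sum>v\<in>V. \<Sum>w\<in>V. \<omega> v w * ((p v - p w) \<bullet> (dp v - dp w))) =
        (\<Sum>v\<in>V. \<Sum>w\<in>V. \<omega> v w * ((r v + r w) * (c v + c w)))"
      by (intro sum.cong refl edge)
    then show ?thesis by (simp add: sum.distrib[symmetric] algebra_simps)
  qed
  also have "\<dots> = 2 * (\<Sum>v\<in>V. \<Sum>w\<in>V. \<omega> v w * ((r v + r w) * c v))"
    using swap[of "\<lambda>v w. (r v + r w) * c v"] by simp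
  also have "\<dots> = 2 * (\<Sum>v\<in>V. (c v)\<^sup>2)"
    by (simp add: c_def power2_eq_square sum_distrib_right mult.assoc)
  finally have "(\<Sum>v\<in>V. (c v)\<^sup>2) = 0" by simp
  then have "c v = 0"
    using \<open>finite V\<close> assms(4) by (simp add: sum_nonneg_eq_0_iff V_def)
  then show ?thesis
    using nbrs[of v "\<lambda>w. r v + r w"] by (simp add: c_def)
qed

text \<open>
  The vectors (x, |x|) to the tangent spheres are null vectors of a Lorentz form L, and that the
  spheres do not overlap makes their mutual products positive. A symmetric 3 by 3 matrix with zero
  diagonal and positive entries elsewhere is regular. The conditions on the third sphere are
  conditional on a nonzero coefficient, so that vertices with only two stressed edges are covered
  as well.
\<close>

lemma tangent_spheres_independent:
  fixes x y z :: "real ^ 3"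
  assumes x: "norm x = \<rho> + a" and y: "norm y = \<rho> + b"
    and pos: "0 < a" "0 < b" and sep: "a + b \<le> norm (x - y)"
    and z: "\<gamma> \<noteq> 0 \<Longrightarrow> norm z = \<rho> + c \<and> 0 < c \<and> a + c \<le> norm (x - z) \<and> b + c \<le> norm (y - z)"
    and lin: "\<alpha> *\<^sub>R x + \<beta> *\<^sub>R y + \<gamma> *\<^sub>R z = 0" "\<alpha> * (\<rho> + a) + \<beta> * (\<rho> + b) + \<gamma> * (\<rho> + c) = 0"
  shows "\<alpha> = 0 \<and> \<beta> = 0 \<and> \<gamma> = 0"
proof -
  define L where "L u v s t = (\<rho> + s) * (\<rho> + t) - u \<bullet> v" for u v :: "real ^ 3" and s t
  have L_pos: "0 < L u v s t"
    if "norm u = \<rho> + s" "norm v = \<rho> + t" "0 < s" "0 < t" "s + t \<le> norm (u - v)" for u v s t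
  proof -
    have "(s + t)\<^sup>2 \<le> (norm (u - v))\<^sup>2"
      using that by (intro power_mono) auto
    also have "\<dots> = (norm u)\<^sup>2 + (norm v)\<^sup>2 - 2 * (u \<bullet> v)"
      by (simp add: power2_norm_eq_inner algebra_simps inner_commute)
    also have "\<dots> = (s - t)\<^sup>2 + 2 * L u v s t"
      unfolding that(1,2) L_def by (simp add: power2_eq_square algebra_simps)
    finally have "4 * (s * t) \<le> 2 * L u v s t"
      by (simp add: power2_eq_square algebra_simps)
    moreover have "0 < s * t" using that by simp
    ultimately show ?thesis by linarith
  qed
  have null: "L u u s s = 0" if "norm u = \<rho> + s" for u s
    using that by (simp add: L_def power2_norm_eq_inner[symmetric] power2_eq_square)
  have sym: "L u v s t = L v u t s" for u v s t
    by (simp add: L_def inner_commute mult.commute)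
  have row: "\<alpha> * L x u a s + \<beta> * L y u b s + \<gamma> * L z u c s = 0" for u s
  proof -
    have "\<alpha> * L x u a s + \<beta> * L y u b s + \<gamma> * L z u c s =
        (\<alpha> * (\<rho> + a) + \<beta> * (\<rho> + b) + \<gamma> * (\<rho> + c)) * (\<rho> + s) - (\<alpha> *\<^sub>R x + \<beta> *\<^sub>R y + \<gamma> *\<^sub>R z) \<bullet> u"
      by (simp add: L_def inner_add_left algebra_simps)
    then show ?thesis using lin by simp
  qed
  define C where "C = L x y a b"
  have C: "0 < C"
    unfolding C_def using x y pos sep by (intro L_pos)
  have e: "\<beta> * C + \<gamma> * L z x c a = 0" "\<alpha> * C + \<gamma> * L z y c b = 0"
    using row[of x a] row[of y b] null[OF x] null[OF y] sym[of y x] by (simp_all add: C_def)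
  have "\<gamma> = 0"
  proof (rule ccontr)
    assume "\<gamma> \<noteq> 0"
    note z = z[OF this]
    define A B where "A = L y z b c" and "B = L x z a c"
    have AB: "0 < A" "0 < B"
      unfolding A_def B_def using x y z pos by (auto intro!: L_pos)
    have "\<alpha> * B + \<beta> * A = 0"
      using row[of z c] null[of z c] z by (simp add: A_def B_def)
    moreover have "2 * \<gamma> * (A * B) = A * (\<beta> * C + \<gamma> * B) + B * (\<alpha> * C + \<gamma> * A) - C * (\<alpha> * B + \<beta> * A)"
      by (simp add: algebra_simps)
    ultimately have "2 * \<gamma> * (A * B) = 0"
      using e sym[of z x] sym[of z y] by (simp add: A_def B_def)
    with AB \<open>\<gamma> \<noteq> 0\<close> show False by simp
  qed
  with e C show ?thesis by simp
qed

text \<open>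
  Among the vertices of the forest with a stressed edge, one has at most one neighbour of the same
  kind. Its stressed edges lead to at most three spheres, against the independence of their null
  vectors.
\<close>

lemma stress_free_of_generic_sphere_packing:
  assumes G: "pair_graph G" and forest: "forest_graph G"
    and pack: "sphere_packing (graph_join G K2) p r" and gen: "generic_radii (graph_join G K2) r"
  shows "stress_free (graph_join G K2) p"
  unfolding stress_free_def
proof (intro allI impI)
  fix \<sigma> assume stress: "equilibrium_stress (graph_join G K2) p \<sigma>"
  let ?H = "graph_join G K2"
  interpret G: pair_graph G by (rule G)
  interpret H: pair_graph ?H using pack by (simp add: sphere_packing_def)
  have pos: "0 < r x" if "x \<in> pverts ?H" for x
    using pack that unfolding sphere_packing_def by blast
  have sep: "r x + r y \<le> norm (p x - p y)" if "x \<in> pverts ?H" "y \<in> pverts ?H" "x \<noteq> y" for x y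
    using pack that unfolding sphere_packing_def by blast
  have tangent: "norm (p x - p y) = r x + r y" if "(x, y) \<in> parcs ?H" for x y
  proof -
    have "x \<in> pverts ?H" "y \<in> pverts ?H" "x \<noteq> y"
      using that H.no_loops' by (auto dest: H.in_arcsD1 H.in_arcsD2)
    then show ?thesis using pack that unfolding sphere_packing_def by blast
  qed
  define U where "U = {v \<in> pverts G. \<exists>x. (Inl v, x) \<in> parcs ?H \<and> \<sigma> {Inl v, x} \<noteq> 0}"
  have "U = {}"
  proof (rule ccontr)
    assume "U \<noteq> {}"
    then obtain v where v: "v \<in> U"
      and leaf: "\<And>w w'. w \<in> U \<Longrightarrow> w' \<in> U \<Longrightarrow> (v, w) \<in> parcs G \<Longrightarrow> (v, w') \<in> parcs G \<Longrightarrow> w = w'"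
      using forest_vertex_of_degree_at_most_one[OF G forest, of U] unfolding U_def by blast
    have vG: "v \<in> pverts G" using v by (simp add: U_def)
    let ?A = "Inr True :: 'a + bool" and ?B = "Inr False :: 'a + bool"
    \<comment> \<open>At v only the two apexes and at most one further sphere can carry stress.\<close>
    have zero: "\<sigma> {Inl v, Inl w} = 0" if "(v, w) \<in> parcs G" "w \<notin> U" for w
    proof -
      have "w \<in> pverts G" "(Inl w, Inl v) \<in> parcs ?H"
        using that by (auto dest: G.in_arcsD2 simp: G.arcs_symmetric)
      then show ?thesis
        using that(2) unfolding U_def by (auto simp: insert_commute)
    qed
    obtain y \<gamma> where y: "\<gamma> \<noteq> 0 \<Longrightarrow> (Inl v, y) \<in> parcs ?H \<and> y \<noteq> ?A \<and> y \<noteq> ?B"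
      and supp: "\<And>x. (Inl v, x) \<in> parcs ?H \<Longrightarrow> x \<noteq> ?A \<Longrightarrow> x \<noteq> ?B \<Longrightarrow> \<sigma> {Inl v, x} = (if x = y then \<gamma> else 0)"
    proof (cases "\<exists>w. w \<in> U \<and> (v, w) \<in> parcs G")
      case True
      then obtain w where w: "w \<in> U" "(v, w) \<in> parcs G" by blast
      show ?thesis
      proof (rule that[of "\<sigma> {Inl v, Inl w}" "Inl w"])
        fix x assume x: "(Inl v, x) \<in> parcs ?H" "x \<noteq> ?A" "x \<noteq> ?B"
        then obtain w' where w': "x = Inl w'" "(v, w') \<in> parcs G"
          by (cases x) auto
        show "\<sigma> {Inl v, x} = (if x = Inl w then \<sigma> {Inl v, Inl w} else 0)"
          using w' zero[of w'] leaf[OF w(1) _ w(2), of w'] by auto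
      qed (use w in simp)
    next
      case False
      show ?thesis
      proof (rule that[of 0 ?A])
        fix x assume x: "(Inl v, x) \<in> parcs ?H" "x \<noteq> ?A" "x \<noteq> ?B"
        then obtain w' where w': "x = Inl w'" "(v, w') \<in> parcs G"
          by (cases x) auto
        then show "\<sigma> {Inl v, x} = (if x = ?A then 0 else 0)"
          using zero[of w'] False by auto
      qed simp
    qed
    define \<alpha> \<beta> where "\<alpha> = \<sigma> {Inl v, ?A}" and "\<beta> = \<sigma> {Inl v, ?B}"
    define Nb where "Nb = {x. (Inl v, x) \<in> parcs ?H}"
    have Nb: "finite Nb" "?A \<in> Nb" "?B \<in> Nb" "\<gamma> \<noteq> 0 \<Longrightarrow> y \<in> Nb"
      using vG y finite_subset[of Nb "pverts ?H"] by (auto simp: Nb_def dest: H.in_arcsD2)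
    have sum3: "(\<Sum>x\<in>Nb. \<sigma> {Inl v, x} *\<^sub>R g x) = \<alpha> *\<^sub>R g ?A + \<beta> *\<^sub>R g ?B + \<gamma> *\<^sub>R g y"
      for g :: "'a + bool \<Rightarrow> 'b::real_vector"
    proof -
      have "(\<Sum>x\<in>Nb. \<sigma> {Inl v, x} *\<^sub>R g x) = (\<Sum>x\<in>Nb. (if x = ?A then \<alpha> *\<^sub>R g ?A else 0) +
          (if x = ?B then \<beta> *\<^sub>R g ?B else 0) + (if x = y then \<gamma> *\<^sub>R g y else 0))"
        using y supp by (intro sum.cong refl) (auto simp: \<alpha>_def \<beta>_def Nb_def)
      also have "\<dots> = \<alpha> *\<^sub>R g ?A + \<beta> *\<^sub>R g ?B + \<gamma> *\<^sub>R g y"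
        using Nb by (cases "\<gamma> = 0") (simp_all add: sum.distrib)
      finally show ?thesis .
    qed
    have "\<alpha> = 0 \<and> \<beta> = 0 \<and> \<gamma> = 0"
    proof (rule tangent_spheres_independent)
      show "norm (p (Inl v) - p ?A) = r (Inl v) + r ?A" "norm (p (Inl v) - p ?B) = r (Inl v) + r ?B"
        using vG by (auto intro: tangent)
      show "0 < r ?A" "0 < r ?B" by (auto intro: pos)
      show "r ?A + r ?B \<le> norm ((p (Inl v) - p ?A) - (p (Inl v) - p ?B))"
        using sep[of ?B ?A] by (simp add: add.commute)
      show "norm (p (Inl v) - p y) = r (Inl v) + r y \<and> 0 < r y \<and>
          r ?A + r y \<le> norm ((p (Inl v) - p ?A) - (p (Inl v) - p y)) \<and>
          r ?B + r y \<le> norm ((p (Inl v) - p ?B) - (p (Inl v) - p y))" if "\<gamma> \<noteq> 0"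
        using y[OF that] tangent[of "Inl v" y] H.in_arcsD2[of "Inl v" y] pos[of y] sep[of y ?A] sep[of y ?B]
        by (auto simp: add.commute)
      show "\<alpha> *\<^sub>R (p (Inl v) - p ?A) + \<beta> *\<^sub>R (p (Inl v) - p ?B) + \<gamma> *\<^sub>R (p (Inl v) - p y) = 0"
      proof -
        have "(\<Sum>x\<in>Nb. \<sigma> {Inl v, x} *\<^sub>R (p (Inl v) - p x)) = 0"
          unfolding Nb_def using stress[unfolded equilibrium_stress_def, THEN bspec, of "Inl v"] vG by simp
        then show ?thesis by (simp only: sum3)
      qed
      show "\<alpha> * (r (Inl v) + r ?A) + \<beta> * (r (Inl v) + r ?B) + \<gamma> * (r (Inl v) + r y) = 0"
        using stress_radius_equation[OF pack gen stress, of "Inl v"] vG sum3[of "\<lambda>x. r (Inl v) + r x"]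
        by (simp add: Nb_def[symmetric])
    qed
    then have "\<sigma> {Inl v, x} = 0" if "(Inl v, x) \<in> parcs ?H" for x
      using supp[OF that] by (cases "x = ?A \<or> x = ?B") (auto simp: \<alpha>_def \<beta>_def)
    then show False using v by (auto simp: U_def)
  qed
  then have Inl_zero: "\<sigma> {Inl v, x} = 0" if "(Inl v, x) \<in> parcs ?H" for v x
    using that H.in_arcsD1[OF that] by (auto simp: U_def)
  have "\<sigma> {x, y} = 0" if xy: "(x, y) \<in> parcs ?H" for x y
  proof (cases x)
    case (Inl v)
    with Inl_zero xy show ?thesis by simp
  next
    case x: (Inr c)
    show ?thesis
    proof (cases y)
      case (Inl v)
      with Inl_zero[of v x] xy show ?thesis by (simp add: insert_commute x)
    next
      case y: (Inr d)
      have fin: "finite {z. (x, z) \<in> parcs ?H}"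
        by (rule finite_subset[of _ "pverts ?H"]) (auto dest: H.in_arcsD2)
      have other: "\<sigma> {x, z} = 0" if z: "(x, z) \<in> parcs ?H" "z \<noteq> y" for z
      proof -
        obtain v where "z = Inl v"
        proof (cases z)
          case (Inr b)
          then show ?thesis using z xy x y by (cases b; cases c; cases d) auto
        qed
        with Inl_zero[of v x] z show ?thesis by (simp add: insert_commute x)
      qed
      have "0 = (\<Sum>z \<in> {z. (x, z) \<in> parcs ?H}. \<sigma> {x, z} *\<^sub>R (p x - p z))"
        using stress H.in_arcsD1[OF xy] by (simp add: equilibrium_stress_def)
      also have "\<dots> = (\<Sum>z \<in> {z. (x, z) \<in> parcs ?H}. if z = y then \<sigma> {x, y} *\<^sub>R (p x - p y) else 0)"
        by (intro sum.cong refl) (auto simp: other)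
      also have "\<dots> = \<sigma> {x, y} *\<^sub>R (p x - p y)"
        using fin xy by simp
      finally have "\<sigma> {x, y} = 0 \<or> norm (p x - p y) = 0" by auto
      moreover have "0 < norm (p x - p y)"
        using tangent[OF xy] pos[of x] pos[of y] by (simp add: x y add_pos_pos)
      ultimately show ?thesis by simp
    qed
  qed
  then show "\<forall>(v, w)\<in>parcs ?H. \<sigma> {v, w} = 0" by blast
qed

section \<open>Flexibility of forests of pennies\<close>

text \<open>
  In the triangle with vertices 0, w, c the third vertex is a continuous function of w and of the
  two side lengths at c as long as the triangle is not degenerate. The formula for c / w has real
  part alpha by the cosine rule, and the sign of its imaginary part selects the side of the line
  through 0 and w.
\<close>

lemma rigid_triangle_continuous:
  fixes W :: "'x \<Rightarrow> complex" and \<rho> :: "'x \<Rightarrow> real"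
  assumes W: "(W \<longlongrightarrow> w) F" and \<rho>: "(\<rho> \<longlongrightarrow> cmod c) F"
    and dist: "cmod (c - w) = 2" and triangle: "Im (c / w) \<noteq> 0"
  shows "\<exists>C. (C \<longlongrightarrow> c) F \<and> (\<forall>\<^sub>F x in F. cmod (C x) = \<rho> x \<and> cmod (C x - W x) = 2)"
proof -
  have "w \<noteq> 0" "c \<noteq> 0" using triangle by auto
  define z where "z = c / w"
  have c: "c = w * z" using \<open>w \<noteq> 0\<close> by (simp add: z_def)
  define \<alpha> where "\<alpha> x = ((\<rho> x)\<^sup>2 + (cmod (W x))\<^sup>2 - 4) / (2 * (cmod (W x))\<^sup>2)" for x
  define \<delta> where "\<delta> x = (\<rho> x)\<^sup>2 / (cmod (W x))\<^sup>2 - (\<alpha> x)\<^sup>2" for x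
  define C where "C x = W x * Complex (\<alpha> x) (sgn (Im z) * sqrt (\<delta> x))" for x
  have N: "(cmod c)\<^sup>2 = (cmod w)\<^sup>2 * (cmod z)\<^sup>2"
    by (simp add: c norm_mult power_mult_distrib)
  have "4 = (cmod w)\<^sup>2 * (cmod (z - 1))\<^sup>2"
    using dist by (simp add: c power_mult_distrib[symmetric] norm_mult[symmetric] algebra_simps)
  then have Re_z: "Re z = ((cmod c)\<^sup>2 + (cmod w)\<^sup>2 - 4) / (2 * (cmod w)\<^sup>2)"
  proof -
    have "(cmod (z - 1))\<^sup>2 = (cmod z)\<^sup>2 - 2 * Re z + 1"
      unfolding cmod_power2 by (simp add: power2_eq_square algebra_simps)
    with \<open>4 = _\<close> have "Re z * (2 * (cmod w)\<^sup>2) = (cmod c)\<^sup>2 + (cmod w)\<^sup>2 - 4"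
      unfolding N by (simp add: algebra_simps)
    then show ?thesis using \<open>w \<noteq> 0\<close> by (simp add: eq_divide_eq)
  qed
  have \<alpha>: "(\<alpha> \<longlongrightarrow> Re z) F"
    unfolding Re_z \<alpha>_def using \<open>w \<noteq> 0\<close> by (intro tendsto_intros W \<rho>) auto
  have "(cmod c)\<^sup>2 / (cmod w)\<^sup>2 = (cmod z)\<^sup>2"
    using \<open>w \<noteq> 0\<close> unfolding N by simp
  then have "(cmod c)\<^sup>2 / (cmod w)\<^sup>2 - (Re z)\<^sup>2 = (Im z)\<^sup>2"
    by (simp add: cmod_power2[of z])
  moreover have "(\<delta> \<longlongrightarrow> (cmod c)\<^sup>2 / (cmod w)\<^sup>2 - (Re z)\<^sup>2) F"
    unfolding \<delta>_def using \<open>w \<noteq> 0\<close> by (intro tendsto_intros W \<rho> \<alpha>) auto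
  ultimately have \<delta>: "(\<delta> \<longlongrightarrow> (Im z)\<^sup>2) F" by simp
  have "(C \<longlongrightarrow> w * Complex (Re z) (sgn (Im z) * sqrt ((Im z)\<^sup>2))) F"
    unfolding C_def by (intro tendsto_intros W \<alpha> \<delta>)
  then have C_lim: "(C \<longlongrightarrow> c) F"
    by (simp add: c sgn_mult_abs)
  have "\<forall>\<^sub>F x in F. 0 < \<delta> x"
    using triangle by (intro order_tendstoD(1)[OF \<delta>]) (simp add: z_def)
  moreover have "\<forall>\<^sub>F x in F. 0 < cmod (W x)"
    using \<open>w \<noteq> 0\<close> by (intro order_tendstoD(1)[OF tendsto_norm[OF W]]) simp
  moreover have "\<forall>\<^sub>F x in F. 0 < \<rho> x"
    using \<open>c \<noteq> 0\<close> by (intro order_tendstoD(1)[OF \<rho>]) simp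
  ultimately have "\<forall>\<^sub>F x in F. cmod (C x) = \<rho> x \<and> cmod (C x - W x) = 2"
  proof eventually_elim
    case (elim x)
    \<comment> \<open>Here cmod (W x)^2 * (alpha^2 + delta) = rho^2 by the choice of delta, and expanding the second
      square with the definition of alpha leaves 4.\<close>
    have sq: "(sgn (Im z) * sqrt (\<delta> x))\<^sup>2 = \<delta> x"
      using elim triangle by (simp add: power_mult_distrib z_def sgn_if)
    have "(cmod (C x))\<^sup>2 = (cmod (W x))\<^sup>2 * ((\<alpha> x)\<^sup>2 + \<delta> x)"
      by (simp add: C_def norm_mult power_mult_distrib cmod_power2[of "Complex _ _"] sq[unfolded power_mult_distrib])
    also have "\<dots> = (\<rho> x)\<^sup>2"
      using elim by (simp add: \<delta>_def)
    finally have C1: "(cmod (C x))\<^sup>2 = (\<rho> x)\<^sup>2" .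
    have "C x - W x = W x * Complex (\<alpha> x - 1) (sgn (Im z) * sqrt (\<delta> x))"
      by (simp add: C_def complex_eq_iff algebra_simps)
    then have "(cmod (C x - W x))\<^sup>2 = (cmod (W x))\<^sup>2 * ((\<alpha> x - 1)\<^sup>2 + \<delta> x)"
      by (simp add: norm_mult power_mult_distrib cmod_power2[of "Complex _ _"] sq[unfolded power_mult_distrib])
    also have "\<dots> = (cmod (W x))\<^sup>2 * ((\<alpha> x)\<^sup>2 + \<delta> x) - \<alpha> x * (2 * (cmod (W x))\<^sup>2) + (cmod (W x))\<^sup>2"
      by (simp add: power2_eq_square algebra_simps)
    also have "\<dots> = (\<rho> x)\<^sup>2 - ((\<rho> x)\<^sup>2 + (cmod (W x))\<^sup>2 - 4) + (cmod (W x))\<^sup>2"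
      using elim by (simp add: \<delta>_def \<alpha>_def)
    finally have "(cmod (C x - W x))\<^sup>2 = 2\<^sup>2" by simp
    then have "cmod (C x - W x) = 2" by (subst (asm) power2_eq_iff_nonneg) auto
    moreover have "cmod (C x) = \<rho> x"
      using C1 elim by (subst (asm) power2_eq_iff_nonneg) auto
    ultimately show ?case by simp
  qed
  with C_lim show ?thesis by blast
qed

text \<open>
  A forest of pennies can follow any small change of the distances to the origin: it is rebuilt by
  attaching one leaf at a time, and each leaf is a triangle over at most one earlier point. The
  small change is expressed by functions that converge along an arbitrary filter F.
\<close>

lemma forest_flexible:
  fixes \<rho> :: "'a \<Rightarrow> 'x \<Rightarrow> real"
  assumes G: "pair_graph G" and forest: "forest_graph G" and "U \<subseteq> pverts G"
    and edge: "\<And>v w. (v, w) \<in> parcs G \<Longrightarrow> cmod (q v - q w) = 2 \<and> Im (q v / q w) \<noteq> 0"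
    and nz: "\<And>v. v \<in> pverts G \<Longrightarrow> q v \<noteq> 0"
    and \<rho>: "\<And>v. v \<in> pverts G \<Longrightarrow> (\<rho> v \<longlongrightarrow> cmod (q v)) F"
  shows "\<exists>Q. (\<forall>v\<in>U. (Q v \<longlongrightarrow> q v) F \<and> (\<forall>\<^sub>F x in F. cmod (Q v x) = \<rho> v x)) \<and>
    (\<forall>v\<in>U. \<forall>w\<in>U. (v, w) \<in> parcs G \<longrightarrow> (\<forall>\<^sub>F x in F. cmod (Q v x - Q w x) = 2))"
proof -
  interpret pair_graph G by (rule G)
  have "finite U" using assms(3) pair_finite_verts by (rule finite_subset)
  then show ?thesis using assms(3)
  proof (induction U rule: finite_psubset_induct)
    case (psubset U)
    show ?case
    proof (cases "U = {}")
      case False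
      then obtain v where v: "v \<in> U"
        and leaf: "\<forall>w\<in>U. \<forall>w'\<in>U. (v, w) \<in> parcs G \<longrightarrow> (v, w') \<in> parcs G \<longrightarrow> w = w'"
        using forest_vertex_of_degree_at_most_one[OF G forest] psubset.prems by blast
      have vG: "v \<in> pverts G" using v psubset.prems by blast
      obtain Q where Q: "\<And>u. u \<in> U - {v} \<Longrightarrow> (Q u \<longlongrightarrow> q u) F \<and> (\<forall>\<^sub>F x in F. cmod (Q u x) = \<rho> u x)"
        and Q_edge: "\<And>u w. u \<in> U - {v} \<Longrightarrow> w \<in> U - {v} \<Longrightarrow> (u, w) \<in> parcs G \<Longrightarrow>
          (\<forall>\<^sub>F x in F. cmod (Q u x - Q w x) = 2)"
        using psubset.IH[of "U - {v}"] v psubset.prems by blast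
      have "\<exists>C. (C \<longlongrightarrow> q v) F \<and> (\<forall>\<^sub>F x in F. cmod (C x) = \<rho> v x) \<and>
          (\<forall>w\<in>U. (v, w) \<in> parcs G \<longrightarrow> (\<forall>\<^sub>F x in F. cmod (C x - Q w x) = 2))"
      proof (cases "\<exists>w\<in>U. (v, w) \<in> parcs G")
        case True
        then obtain w where w: "w \<in> U" "(v, w) \<in> parcs G" by blast
        then have "w \<in> U - {v}" using no_loops' by auto
        then obtain C where C: "(C \<longlongrightarrow> q v) F"
          "\<forall>\<^sub>F x in F. cmod (C x) = \<rho> v x \<and> cmod (C x - Q w x) = 2"
          using rigid_triangle_continuous[of "Q w" "q w" F "\<rho> v" "q v"] Q[of w] \<rho>[OF vG] edge[OF w(2)] by blast
        have "w' = w" if "w' \<in> U" "(v, w') \<in> parcs G" for w'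
          using leaf w that by blast
        with C show ?thesis
          by (intro exI[of _ C]) (auto elim: eventually_mono)
      next
        case False
        \<comment> \<open>An isolated vertex moves along its ray from the origin.\<close>
        define C where "C x = of_real (\<rho> v x / cmod (q v)) * q v" for x
        have "(C \<longlongrightarrow> of_real (cmod (q v) / cmod (q v)) * q v) F"
          unfolding C_def using nz[OF vG] by (intro tendsto_intros \<rho>[OF vG]) auto
        then have "(C \<longlongrightarrow> q v) F" using nz[OF vG] by simp
        moreover have "\<forall>\<^sub>F x in F. 0 < \<rho> v x"
          using nz[OF vG] by (intro order_tendstoD(1)[OF \<rho>[OF vG]]) simp
        then have "\<forall>\<^sub>F x in F. cmod (C x) = \<rho> v x"
          by eventually_elim (use nz[OF vG] in \<open>simp add: C_def norm_mult norm_divide\<close>)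
        ultimately show ?thesis using False by blast
      qed
      then obtain C where C: "(C \<longlongrightarrow> q v) F" "\<forall>\<^sub>F x in F. cmod (C x) = \<rho> v x"
        and C_edge: "\<And>w. w \<in> U \<Longrightarrow> (v, w) \<in> parcs G \<Longrightarrow> \<forall>\<^sub>F x in F. cmod (C x - Q w x) = 2" by blast
      have "\<forall>\<^sub>F x in F. cmod ((Q(v := C)) u x - (Q(v := C)) w x) = 2"
        if u: "u \<in> U" and w: "w \<in> U" and uw: "(u, w) \<in> parcs G" for u w
      proof -
        have "u \<noteq> w" "(w, u) \<in> parcs G"
          using uw no_loops' arcs_symmetric by auto
        then show ?thesis
          using Q_edge[of u w] C_edge[of w] C_edge[of u] u w uw
          by (cases "u = v"; cases "w = v") (simp_all add: norm_minus_commute)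
      qed
      with Q C show ?thesis
        by (intro exI[of _ "Q(v := C)"]) auto
    qed simp
  qed
qed

text \<open>
  The origin can be moved outside all pennies and off the line of every edge, as the nondegenerate
  triangles require.
\<close>

lemma penny_position_general_origin:
  assumes G: "pair_graph G" and q: "penny_position G q"
  shows "\<exists>q'. penny_position G q' \<and> (\<forall>v\<in>pverts G. 1 < cmod (q' v)) \<and>
    (\<forall>(v, w)\<in>parcs G. Im (q' v / q' w) \<noteq> 0)"
proof -
  interpret pair_graph G by (rule G)
  define M where "M = 1 + (\<Sum>v\<in>pverts G. cmod (q v))"
  define P where "P e = (case e of (v, w) \<Rightarrow>
    [:Im (q v) * Re (q w) - Re (q v) * Im (q w), Im (q w) - Im (q v), Re (q v) - Re (q w):])" for e
  have "P e \<noteq> 0" if "e \<in> parcs G" for e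
  proof -
    obtain v w where e: "e = (v, w)" by (cases e)
    have "v \<in> pverts G" "w \<in> pverts G" "v \<noteq> w"
      using that no_loops' unfolding e by (auto dest: in_arcsD1 in_arcsD2)
    then have "q v \<noteq> q w"
      using q unfolding penny_position_def by force
    then show ?thesis by (auto simp: P_def e complex_eq_iff)
  qed
  then have "finite (\<Union>e\<in>parcs G. {t. poly (P e) t = 0})"
    using pair_finite_arcs by (auto intro: poly_roots_finite)
  moreover have "infinite {M<..}" by (rule infinite_Ioi)
  ultimately obtain t where t: "t \<in> {M<..}" "t \<notin> (\<Union>e\<in>parcs G. {t. poly (P e) t = 0})"
    by (metis finite_subset subsetI)
  \<comment> \<open>The origin moves along a parabola: no line through two of the points contains infinitely many points of the parabola.\<close>
  define q' where "q' v = q v - Complex t (t\<^sup>2)" for v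
  have "1 < cmod (q' v)" if "v \<in> pverts G" for v
  proof -
    have "cmod (q v) \<le> (\<Sum>v\<in>pverts G. cmod (q v))"
      using that by (intro member_le_sum) auto
    then have "1 < t - Re (q v)"
      using t(1) complex_Re_le_cmod[of "q v"] by (simp add: M_def)
    also have "\<dots> \<le> \<bar>Re (q' v)\<bar>" by (simp add: q'_def)
    also have "\<dots> \<le> cmod (q' v)" by (rule abs_Re_le_cmod)
    finally show ?thesis .
  qed
  moreover have "Im (q' v / q' w) \<noteq> 0" if "(v, w) \<in> parcs G" for v w
  proof -
    have "poly (P (v, w)) t \<noteq> 0" using t(2) that by blast
    moreover have "poly (P (v, w)) t = Im (q' v) * Re (q' w) - Re (q' v) * Im (q' w)"
      by (simp add: P_def q'_def power2_eq_square algebra_simps)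
    ultimately have nz: "Im (q' v) * Re (q' w) - Re (q' v) * Im (q' w) \<noteq> 0" by simp
    then have "(Re (q' w))\<^sup>2 + (Im (q' w))\<^sup>2 \<noteq> 0"
      by (auto simp: sum_power2_eq_zero_iff)
    with nz show ?thesis by (simp add: Im_divide)
  qed
  moreover have "penny_position G q'"
    using q by (simp add: penny_position_def q'_def)
  ultimately show ?thesis by blast
qed

text \<open>
  Start from two unit apexes and the radii that belong to the given penny packing, and approximate
  these radii by algebraically independent ones. The forest follows the resulting change of
  distances, and the strict inequalities between pennies that do not touch persist.
\<close>

lemma generic_sphere_packing_exists:
  assumes G: "pair_graph G" and forest: "forest_graph G" and "penny_graph G"
  shows "\<exists>p r. sphere_packing (graph_join G K2) p r \<and> generic_radii (graph_join G K2) r"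
proof -
  interpret pair_graph G by (rule G)
  let ?H = "graph_join G K2" and ?A = "Inr True :: 'a + bool" and ?B = "Inr False :: 'a + bool"
  have finH: "finite (pverts ?H)"
    by (simp add: graph_join_def K2_def)
  obtain q where q: "penny_position G q" and far: "\<And>v. v \<in> pverts G \<Longrightarrow> 1 < cmod (q v)"
    and nondeg: "\<And>v w. (v, w) \<in> parcs G \<Longrightarrow> Im (q v / q w) \<noteq> 0"
    using assms(3) penny_position_general_origin[OF G] unfolding penny_graph_iff_penny_position by blast
  have gap: "1 < (cmod (q v))\<^sup>2" if "v \<in> pverts G" for v
    using far[OF that] by (simp add: power2_eq_square) (metis less_1_mult)
  \<comment> \<open>With two unit apexes the radius relation reads norm q squared = 2 / r + 1.\<close>
  define x0 where "x0 x = (case x of Inl v \<Rightarrow> 2 / ((cmod (q v))\<^sup>2 - 1) | Inr c \<Rightarrow> 1)" for x :: "'a + bool"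
  have "\<exists>x. algebraically_independent_over_rat (pverts ?H) x \<and> (\<forall>i\<in>pverts ?H. \<bar>x i - x0 i\<bar> < 1 / real (Suc n))" for n
    using algebraically_independent_dense[OF finH, of "1 / real (Suc n)" x0] by simp
  then obtain R where indep: "\<And>n. algebraically_independent_over_rat (pverts ?H) (R n)"
    and near: "\<And>n i. i \<in> pverts ?H \<Longrightarrow> \<bar>R n i - x0 i\<bar> < 1 / real (Suc n)"
    by metis
  have lim: "(\<lambda>n. R n i) \<longlonglongrightarrow> x0 i" if "i \<in> pverts ?H" for i
  proof (rule LIMSEQ_I)
    fix e :: real assume "0 < e"
    then obtain N where N: "1 / real (Suc N) < e"
      using nat_approx_posE by blast
    have "norm (R n i - x0 i) < e" if "N \<le> n" for n
    proof -
      have "1 / real (Suc n) \<le> 1 / real (Suc N)"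
        using that by (intro divide_left_mono) auto
      then show ?thesis using near[OF \<open>i \<in> pverts ?H\<close>, of n] N by simp
    qed
    then show "\<exists>N. \<forall>n\<ge>N. norm (R n i - x0 i) < e" by blast
  qed
  define \<rho> where "\<rho> v n = sqrt (4 * R n ?A * R n ?B / (R n ?A + R n ?B) / R n (Inl v)
    + 4 * R n ?A * R n ?B / (R n ?A + R n ?B)\<^sup>2)" for v n
  have x0_pos: "0 < x0 i" if "i \<in> pverts ?H" for i
    using that gap by (cases i) (auto simp: x0_def)
  have \<rho>: "\<rho> v \<longlonglongrightarrow> cmod (q v)" if v: "v \<in> pverts G" for v
  proof -
    have "x0 (Inl v) \<noteq> 0" using x0_pos[of "Inl v"] v by simp
    moreover have "x0 ?A = 1" "x0 ?B = 1" by (simp_all add: x0_def)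
    ultimately have "\<rho> v \<longlonglongrightarrow> sqrt (4 * x0 ?A * x0 ?B / (x0 ?A + x0 ?B) / x0 (Inl v) + 4 * x0 ?A * x0 ?B / (x0 ?A + x0 ?B)\<^sup>2)"
      unfolding \<rho>_def using v by (intro tendsto_intros lim) simp_all
    also have "sqrt (4 * x0 ?A * x0 ?B / (x0 ?A + x0 ?B) / x0 (Inl v) + 4 * x0 ?A * x0 ?B / (x0 ?A + x0 ?B)\<^sup>2) = cmod (q v)"
      using gap[OF v] by (simp add: x0_def field_simps)
    finally show ?thesis .
  qed
  have edge: "cmod (q v - q w) = 2 \<and> Im (q v / q w) \<noteq> 0" if "(v, w) \<in> parcs G" for v w
  proof -
    have "v \<in> pverts G" "w \<in> pverts G" "v \<noteq> w"
      using that no_loops' by (auto dest: in_arcsD1 in_arcsD2)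
    then show ?thesis
      using q nondeg[OF that] that unfolding penny_position_def by blast
  qed
  have "\<exists>Q. (\<forall>v\<in>pverts G. Q v \<longlonglongrightarrow> q v \<and> (\<forall>\<^sub>F n in sequentially. cmod (Q v n) = \<rho> v n)) \<and>
      (\<forall>v\<in>pverts G. \<forall>w\<in>pverts G. (v, w) \<in> parcs G \<longrightarrow> (\<forall>\<^sub>F n in sequentially. cmod (Q v n - Q w n) = 2))"
  proof (intro forest_flexible[OF G forest order_refl] edge \<rho>)
    show "q v \<noteq> 0" if "v \<in> pverts G" for v
      using far[OF that] by (intro notI) simp
  qed
  then obtain Q where Q: "\<forall>v\<in>pverts G. Q v \<longlonglongrightarrow> q v \<and> (\<forall>\<^sub>F n in sequentially. cmod (Q v n) = \<rho> v n)"
    and Q_edge: "\<forall>v\<in>pverts G. \<forall>w\<in>pverts G. (v, w) \<in> parcs G \<longrightarrow> (\<forall>\<^sub>F n in sequentially. cmod (Q v n - Q w n) = 2)"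
    by blast
  have "\<forall>\<^sub>F n in sequentially. \<forall>x\<in>pverts ?H. 0 < R n x"
    using x0_pos by (intro eventually_ball_finite finH ballI order_tendstoD(1)[OF lim])
  moreover have "\<forall>\<^sub>F n in sequentially. \<forall>v\<in>pverts G. cmod (Q v n) = \<rho> v n"
    using Q by (intro eventually_ball_finite pair_finite_verts) blast
  moreover have "\<forall>\<^sub>F n in sequentially. \<forall>v\<in>pverts G. \<forall>w\<in>pverts G. v \<noteq> w \<longrightarrow>
      2 \<le> cmod (Q v n - Q w n) \<and> (cmod (Q v n - Q w n) = 2 \<longleftrightarrow> (v, w) \<in> parcs G)"
  proof (intro eventually_ball_finite pair_finite_verts ballI)
    fix v w assume vw: "v \<in> pverts G" "w \<in> pverts G"
    show "\<forall>\<^sub>F n in sequentially. v \<noteq> w \<longrightarrow>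
      2 \<le> cmod (Q v n - Q w n) \<and> (cmod (Q v n - Q w n) = 2 \<longleftrightarrow> (v, w) \<in> parcs G)"
    proof (cases "v = w \<or> (v, w) \<in> parcs G")
      case True
      then have "v = w \<or> (\<forall>\<^sub>F n in sequentially. cmod (Q v n - Q w n) = 2)"
        using Q_edge vw by blast
      then show ?thesis
        using True by (auto elim: eventually_mono)
    next
      case False
      then have "2 < cmod (q v - q w)"
        using q vw unfolding penny_position_def by force
      moreover have "(\<lambda>n. cmod (Q v n - Q w n)) \<longlonglongrightarrow> cmod (q v - q w)"
        using Q vw by (intro tendsto_intros) blast+
      ultimately have "\<forall>\<^sub>F n in sequentially. 2 < cmod (Q v n - Q w n)"
        by (intro order_tendstoD(1))
      then show ?thesis by eventually_elim (use False in auto)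
    qed
  qed
  ultimately have "\<forall>\<^sub>F n in sequentially. (\<forall>x\<in>pverts ?H. 0 < R n x) \<and> (\<forall>v\<in>pverts G. cmod (Q v n) = \<rho> v n) \<and>
      penny_position G (\<lambda>v. Q v n)"
    unfolding penny_position_def by eventually_elim blast
  then have "\<exists>n. (\<forall>x\<in>pverts ?H. 0 < R n x) \<and> (\<forall>v\<in>pverts G. cmod (Q v n) = \<rho> v n) \<and>
      penny_position G (\<lambda>v. Q v n)"
    by (rule eventually_happens'[OF sequentially_bot])
  then obtain n where n: "\<And>x. x \<in> pverts ?H \<Longrightarrow> 0 < R n x" "\<And>v. v \<in> pverts G \<Longrightarrow> cmod (Q v n) = \<rho> v n"
    "penny_position G (\<lambda>v. Q v n)"
    by blast
  have "\<exists>p. sphere_packing ?H p (R n)"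
  proof (rule sphere_packing_of_penny_position[OF G n(3)])
    fix v assume v: "v \<in> pverts G"
    have "0 < R n ?A" "0 < R n ?B" "0 < R n (Inl v)" using n(1) v by simp_all
    then show "radius_relation (R n ?A) (R n ?B) (R n (Inl v)) (Q v n)"
      unfolding radius_relation_def n(2)[OF v] \<rho>_def by (subst real_sqrt_pow2) auto
  qed (use n(1) in simp_all)
  then show ?thesis
    using indep[of n] by (auto simp: generic_radii_def)
qed

section \<open>The characterisation\<close>

theorem theorem1p2:
  fixes G :: "'a pair_pre_digraph"
  assumes "pair_graph G"
  shows "((\<exists>p r. sphere_packing (graph_join G K2) p r \<and> generic_radii (graph_join G K2) r)
           \<longleftrightarrow> forest_graph G \<and> penny_graph G) \<and>
         (\<forall>p r. sphere_packing (graph_join G K2) p r \<and> generic_radii (graph_join G K2) r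
           \<longrightarrow> stress_free (graph_join G K2) p)"
proof (intro conjI iffI allI impI)
  assume "\<exists>p r. sphere_packing (graph_join G K2) p r \<and> generic_radii (graph_join G K2) r"
  then obtain p r where pack: "sphere_packing (graph_join G K2) p r" and gen: "generic_radii (graph_join G K2) r"
    by blast
  show "forest_graph G"
    using forest_of_generic_sphere_packing[OF assms pack gen] .
  show "penny_graph G"
    using penny_position_of_sphere_packing[OF pack] assms penny_graph_iff_penny_position by blast
next
  assume "forest_graph G \<and> penny_graph G"
  then show "\<exists>p r. sphere_packing (graph_join G K2) p r \<and> generic_radii (graph_join G K2) r"
    using generic_sphere_packing_exists[OF assms] by blast
next
  fix p r
  assume "sphere_packing (graph_join G K2) p r \<and> generic_radii (graph_join G K2) r"
  then show "stress_free (graph_join G K2) p"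
    using stress_free_of_generic_sphere_packing[OF assms] forest_of_generic_sphere_packing[OF assms] by blast
qed

end
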